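(* Let $G:[0,+\infty)\times[0,+\infty)\to[0,+\infty)$, $G=G(z,v)$, be continuous in all its arguments, and convex and nondecreasing in $z$. Let $u\in L$. Then $u^*\in L$ and $$\int_I G\bigl(f(x)\,|u'(x)|,\,u(x)\bigr)\,dx\ \ge\ \int_I G\bigl(f(x)\,|(u^* )'(x)|,\,u^*(x)\bigr)\,dx .$$
   Context: Let $\alpha\in(0,+\infty]$, $I=(0,\alpha)$, and let $\overline I$ be the closure of $I$ in $\mathbb R$ (so $\overline I=[0,+\infty)$ if $\alpha=+\infty$). The function $f$ satisfies: $f\in C(\overline I)$ and $f(x)>0$ for all $x\in I$; $f(x_2-x_1)\le f(x_1)+f(x_2)$ whenever $x_1,x_2\in\overline I$ with $x_1\le x_2$; and, if $\alpha<+\infty$, also $f(x)=f(\alpha-x)$ for all $x\in\overline I$. For a measurable set $M\subset I$ of finite Lebesgue measure $|M|$, put $M^*:=(0,|M|)$. Let $S$ be the class of Lebesgue measurable functions $u:I\to[0,+\infty)$ such that $|\{x\in I: u(x)>c\}|<+\infty$ for all $c>0$, and let $L$ be the set of functions $u\in S$ which are Lipschitz continuous and have compact support in $\overline I$. For $u\in S$ the decreasing rearrangement $u^*$ of $u$ is defined by $$u^*(x):=\sup\{c>0:\ x\in\{u(\cdot)>c\}^*\},\quad x\in I,$$ with $\sup\emptyset=0$. *)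

theory Defs
  imports "HOL-Analysis.Analysis"
begin

text \<open>Functions on the interval \<open>I = (0, \<alpha>)\<close> are total functions on the reals whose values
  outside \<open>I\<close> are irrelevant.\<close>

definition ival :: "ereal \<Rightarrow> real set"
  where "ival \<alpha> = {x. 0 < x \<and> ereal x < \<alpha>}"

definition set_rearr :: "real set \<Rightarrow> real set"
  where "set_rearr M = {0<..<measure lebesgue M}"

definition class_S :: "real set \<Rightarrow> (real \<Rightarrow> real) set"
  where "class_S I = {u. u \<in> borel_measurable (lebesgue_on I) \<and> (\<forall>x\<in>I. 0 \<le> u x) \<and>
           (\<forall>c>0. emeasure lebesgue {x \<in> I. u x > c} < \<infinity>)}"

text \<open>The support is the closure of the set of non-zeros in \<open>I\<close>, taken in the closure of \<open>I\<close>
  (equivalently in the reals), so it may contain the end points of \<open>I\<close>.\<close>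

definition class_L :: "real set \<Rightarrow> (real \<Rightarrow> real) set"
  where "class_L I = {u \<in> class_S I. (\<exists>C. C-lipschitz_on I u) \<and>
           compact (closure {x \<in> I. u x \<noteq> 0})}"

text \<open>The empty case is separate because \<open>Sup {}\<close> is unspecified on the reals. For \<open>u\<close> in
  \<open>class_S I\<close> the set of levels is bounded above, since the measure of \<open>{u > c}\<close> tends to 0 as
  \<open>c\<close> grows.\<close>

definition decr_rearr :: "real set \<Rightarrow> (real \<Rightarrow> real) \<Rightarrow> real \<Rightarrow> real"
  where "decr_rearr I u x =
    (let A = {c. c > 0 \<and> x \<in> set_rearr {y \<in> I. u y > c}}
     in if A = {} then 0 else Sup A)"

end

theory Submission
  imports Defs
begin

text \<open>
  For a.e. level \<open>c\<close> the level set \<open>{u = c}\<close> is finite and consists of points where \<open>u'\<close> exists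
  and is nonzero, and the area formula turns the part of the energy carried by such points into

  \<open>\<integral> \<Sum>\<^bsub>u(x) = c\<^esub> G (f(x) |u'(x)|, c) / |u'(x)| dc\<close>.

  The inner sum has the form \<open>\<Sum> a\<^sub>i G (f(x\<^sub>i) / a\<^sub>i, c)\<close> with \<open>a\<^sub>i = 1 / |u'(x\<^sub>i)|\<close>, so Jensen's inequality
  bounds it below by \<open>A G (\<Sum> f(x\<^sub>i) / A, c)\<close> with \<open>A = \<Sum> a\<^sub>i\<close> (\<open>convex_perspective_sum_ge\<close>).
  Two comparisons then lead to the corresponding expression for \<open>w = u\<^sup>*\<close>, whose level set is
  the single point \<open>m(c) = |{u > c}|\<close> or empty.

  First, \<open>\<Sum> f(x\<^sub>i) \<ge> f(m(c))\<close>: this is an isoperimetric inequality for the set \<open>{u > c}\<close>, in which a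
  boundary point \<open>x\<close> inside \<open>I\<close> costs \<open>f(x)\<close>. It follows from \<open>f (y - x) \<le> f x + f y\<close> by walking
  through the boundary points from left to right, and from the symmetry of \<open>f\<close> if \<open>\<alpha>\<close> is finite
  (\<open>weighted_boundary_ge\<close>).

  Second, \<open>A = 1 / |w'(m(c))|\<close>: the functions \<open>u\<close> and \<open>w\<close> have the same distribution, and over regular
  values the density of this distribution is \<open>\<Sum> 1 / |u'(x\<^sub>i)|\<close>, again by the area formula
  (\<open>AE_level_weights_eq\<close>).

  The remaining points are those where \<open>u\<close> takes a value in a null set \<open>Z\<close> containing \<open>0\<close> and all
  critical values. There \<open>u' = 0\<close> a.e., so they contribute \<open>\<integral> G (0, u)\<close> over \<open>{u \<in> Z}\<close>, which depends on
  the distribution of \<open>u\<close> only and is therefore the same for \<open>w\<close>.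

  That \<open>w\<close> is Lipschitz with the constant of \<open>u\<close> is seen on superlevel sets: by the intermediate
  value theorem \<open>u\<close> maps \<open>{c < u \<le> d}\<close> onto at least \<open>(c, d)\<close>, whence \<open>d - c \<le> C (m(c) - m(d))\<close>.

  The analysis on the line that this uses is derived from the Vitali covering theorem through one
  estimate, \<open>emeasure_Lipschitz_image_le_of_fine_cover\<close>: it gives differentiability a.e. of Lipschitz
  functions, and that critical values form a null set.
\<close>

section \<open>Images of sets under Lipschitz functions\<close>

lemma negligible_Lipschitz_image:
  fixes g :: "real \<Rightarrow> real"
  assumes "C-lipschitz_on UNIV g" and "negligible S"
  shows "negligible (g ` S)"
proof (rule negligible_locally_Lipschitz_image[OF _ assms(2)])
  show "\<exists>T B. open T \<and> x \<in> T \<and> (\<forall>y\<in>S \<inter> T. norm (g y - g x) \<le> B * norm (y - x))" for x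
    using lipschitz_onD[OF assms(1)] by (intro exI[of _ UNIV] exI[of _ C]) (auto simp: dist_norm)
qed simp

lemma sets_lebesgue_Lipschitz_image:
  fixes g :: "real \<Rightarrow> real"
  assumes "C-lipschitz_on UNIV g" and "S \<in> sets lebesgue"
  shows "g ` S \<in> sets lebesgue"
  using assms by (intro sets_lebesgue_continuous_image[of S UNIV] lipschitz_on_continuous_on
      negligible_Lipschitz_image) auto

text \<open>
  A bound on the stretching of arbitrarily small intervals around each point of \<open>E\<close> passes to \<open>E\<close>:
  disjoint such intervals, chosen inside an open set barely larger than \<open>E\<close>, exhaust \<open>E\<close> up to a
  null set, and the Lipschitz function \<open>g\<close> maps this null set to a null set. The intervals may depend on
  the point, so the hypothesis covers small difference quotients along some sequence of
  intervals as well as a small derivative.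
\<close>

lemma emeasure_Lipschitz_image_le_of_fine_cover:
  fixes g :: "real \<Rightarrow> real" and p :: real
  assumes g: "C-lipschitz_on UNIV g" and E: "E \<in> sets lebesgue" and p: "0 \<le> p"
    and fine: "\<And>x d. x \<in> E \<Longrightarrow> 0 < d \<Longrightarrow> \<exists>a r. 0 < r \<and> r < d \<and> x \<in> cball a r \<and>
        emeasure lebesgue (g ` cball a r) \<le> ennreal p * emeasure lebesgue (cball a r)"
  shows "emeasure lebesgue (g ` E) \<le> ennreal p * emeasure lebesgue E"
proof -
  have main: "emeasure lebesgue (g ` E) \<le> ennreal p * emeasure lebesgue E + ennreal (p * e)"
    if e: "0 < e" for e
  proof -
    obtain T where T: "open T" "E \<subseteq> T" "emeasure lebesgue (T - E) < ennreal e"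
      using sets_lebesgue_outer_open[OF E e] by metis
    define K where "K = {(a, r). 0 < r \<and> cball a r \<subseteq> T \<and>
        emeasure lebesgue (g ` cball a r) \<le> ennreal p * emeasure lebesgue (cball a r)}"
    have "\<exists>i. i \<in> K \<and> x \<in> cball (fst i) (snd i) \<and> snd i < d" if "x \<in> E" "0 < d" for x d
    proof -
      obtain b where b: "0 < b" "ball x b \<subseteq> T"
        using T \<open>x \<in> E\<close> open_contains_ball by blast
      obtain a r where ar: "0 < r" "r < min d (b/2)" "x \<in> cball a r"
        "emeasure lebesgue (g ` cball a r) \<le> ennreal p * emeasure lebesgue (cball a r)"
        using fine[OF \<open>x \<in> E\<close>, of "min d (b/2)"] \<open>0 < d\<close> b by auto
      have "cball a r \<subseteq> ball x b"
        using ar by (auto simp: dist_real_def)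
      then have "(a, r) \<in> K"
        using ar b by (auto simp: K_def)
      then show ?thesis using ar by (intro exI[of _ "(a, r)"]) auto
    qed
    moreover have Kpos: "\<And>i. i \<in> K \<Longrightarrow> 0 < snd i" by (auto simp: K_def)
    ultimately obtain \<C> where C: "countable \<C>" "\<C> \<subseteq> K"
      "pairwise (\<lambda>i j. disjnt (cball (fst i) (snd i)) (cball (fst j) (snd j))) \<C>"
      "negligible (E - (\<Union>i \<in> \<C>. cball (fst i) (snd i)))"
      by - (rule Vitali_covering_theorem_cballs[of K snd E fst]; blast)
    (* Numbering the family by to_nat_on, with empty sets at unused indices, keeps it disjoint,
       which an enumeration with repetitions would not. *)
    define A where "A n = (if n \<in> to_nat_on \<C> ` \<C> then
       (\<lambda>i. cball (fst i) (snd i)) (from_nat_into \<C> n) else {})" for n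
    have UA: "(\<Union>n. A n) = (\<Union>i \<in> \<C>. cball (fst i) (snd i))"
      using C(1) by (auto simp: A_def) 
    have disj: "disjoint_family A"
      unfolding disjoint_family_on_def
    proof (intro ballI impI)
      fix m n :: nat assume "m \<noteq> n"
      show "A m \<inter> A n = {}"
      proof (cases "m \<in> to_nat_on \<C> ` \<C> \<and> n \<in> to_nat_on \<C> ` \<C>")
        case True
        then obtain i j where ij: "i \<in> \<C>" "j \<in> \<C>" "m = to_nat_on \<C> i" "n = to_nat_on \<C> j"
          by auto
        then have "i \<noteq> j" using \<open>m \<noteq> n\<close> by auto
        then show ?thesis
          using pairwiseD[OF C(3) ij(1,2)] ij C(1) by (simp add: A_def disjnt_def)
      qed (auto simp: A_def)
    qed
    have A_le: "emeasure lebesgue (g ` A n) \<le> ennreal p * emeasure lebesgue (A n)"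
      and A_T: "A n \<subseteq> T" for n
    proof -
      have "emeasure lebesgue (g ` A n) \<le> ennreal p * emeasure lebesgue (A n) \<and> A n \<subseteq> T"
      proof (cases "n \<in> to_nat_on \<C> ` \<C>")
        case True
        then obtain i where i: "i \<in> \<C>" "n = to_nat_on \<C> i" by auto
        then have "A n = cball (fst i) (snd i)" using C(1) by (simp add: A_def)
        moreover have "i \<in> K" using i C(2) by auto
        ultimately show ?thesis by (simp add: K_def case_prod_beta)
      qed (simp add: A_def)
      then show "emeasure lebesgue (g ` A n) \<le> ennreal p * emeasure lebesgue (A n)" "A n \<subseteq> T"
        by auto
    qed
    have Ameas: "A n \<in> sets lebesgue" for n by (auto simp: A_def)
    note img = sets_lebesgue_Lipschitz_image[OF g]
    let ?N = "E - (\<Union>n. A n)"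
    have N: "negligible ?N" using C(4) UA by simp
    have "emeasure lebesgue (g ` E) \<le> emeasure lebesgue ((\<Union>n. g ` A n) \<union> g ` ?N)"
    proof (rule emeasure_mono)
      show "g ` E \<subseteq> (\<Union>n. g ` A n) \<union> g ` ?N" by blast
      show "(\<Union>n. g ` A n) \<union> g ` ?N \<in> sets lebesgue"
        using Ameas negligible_imp_sets[OF N]
        by (intro sets.Un sets.countable_UN image_subsetI img) auto
    qed
    also have "\<dots> = emeasure lebesgue (\<Union>n. g ` A n)"
      using negligible_Lipschitz_image[OF g N] Ameas
      by (intro emeasure_Un_null_set) (auto simp: negligible_iff_null_sets intro!: img)
    also have "\<dots> \<le> (\<Sum>n. emeasure lebesgue (g ` A n))"
      using Ameas by (intro emeasure_subadditive_countably) (auto intro!: img)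
    also have "\<dots> \<le> (\<Sum>n. ennreal p * emeasure lebesgue (A n))"
      by (intro suminf_le A_le) auto
    also have "\<dots> = ennreal p * emeasure lebesgue (\<Union>n. A n)"
      using Ameas disj by (subst suminf_emeasure[symmetric]) (auto)
    also have "\<dots> \<le> ennreal p * emeasure lebesgue T"
      using A_T T Ameas by (intro mult_left_mono emeasure_mono) auto
    also have "\<dots> \<le> ennreal p * (emeasure lebesgue E + emeasure lebesgue (T - E))"
    proof -
      have "emeasure lebesgue T \<le> emeasure lebesgue E + emeasure lebesgue (T - E)"
        using emeasure_subadditive[of E lebesgue "T - E"] E T
        by (simp add: Un_absorb1 sets.Diff)
      then show ?thesis by (intro mult_left_mono) auto
    qed
    also have "\<dots> \<le> ennreal p * (emeasure lebesgue E + ennreal e)"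
      using T(3) by (intro mult_left_mono add_left_mono) auto
    also have "\<dots> = ennreal p * emeasure lebesgue E + ennreal (p * e)"
      using p e by (simp add: distrib_left ennreal_mult)
    finally show ?thesis .
  qed
  show ?thesis
  proof (rule ennreal_le_epsilon)
    fix e :: real assume "0 < e"
    (* The denominator p + 1 in place of p covers the case p = 0. *)
    have "p * (e / (p + 1)) \<le> e" using p \<open>0 < e\<close> by (simp add: field_simps)
    then show "emeasure lebesgue (g ` E) \<le> ennreal p * emeasure lebesgue E + ennreal e"
      using main[of "e / (p + 1)"] p \<open>0 < e\<close>
      by (meson add_left_mono divide_pos_pos dual_order.trans ennreal_leI add_nonneg_pos zero_less_one)
  qed
qed

lemma emeasure_Lipschitz_image_le:
  fixes g :: "real \<Rightarrow> real"
  assumes g: "C-lipschitz_on UNIV g" and E: "E \<in> sets lebesgue"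
  shows "emeasure lebesgue (g ` E) \<le> ennreal C * emeasure lebesgue E"
proof (rule emeasure_Lipschitz_image_le_of_fine_cover[OF g E])
  show C: "0 \<le> C" using g lipschitz_on_nonneg by blast
  fix x d :: real assume "0 < d"
  define r where "r = d / 2"
  have r: "0 < r" "r < d" using \<open>0 < d\<close> by (auto simp: r_def)
  have "g ` cball x r \<subseteq> cball (g x) (C * r)"
  proof (rule image_subsetI)
    fix y assume "y \<in> cball x r"
    then have "dist (g x) (g y) \<le> C * dist x y" "C * dist x y \<le> C * r"
      using lipschitz_onD[OF g, of x y] C by (auto intro: mult_left_mono)
    then show "g y \<in> cball (g x) (C * r)" by simp
  qed
  then have "emeasure lebesgue (g ` cball x r) \<le> emeasure lebesgue (cball (g x) (C * r))"
    by (intro emeasure_mono) auto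
  also have "\<dots> = ennreal C * emeasure lebesgue (cball x r)"
    using C r by (simp add: cball_eq_atLeastAtMost ennreal_mult[symmetric] algebra_simps)
  finally show "\<exists>a r. 0 < r \<and> r < d \<and> x \<in> cball a r \<and>
      emeasure lebesgue (g ` cball a r) \<le> ennreal C * emeasure lebesgue (cball a r)"
    using r by (intro exI[of _ x] exI[of _ r]) auto
qed


section \<open>Differentiability almost everywhere and critical values\<close>

lemma UN_Int_symmetric_intervals: "(\<Union>n. A \<inter> {- real n..real n}) = A"
proof -
  have "\<exists>n. \<bar>x\<bar> \<le> real n" for x using real_arch_simple by blast
  then show ?thesis by (auto simp: abs_le_iff) (metis minus_le_iff)
qed

text \<open>
  Near a point with derivative \<open>0\<close>, small intervals are shrunk by any prescribed factor \<open>p\<close>. Since \<open>p\<close>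
  is arbitrary, the image of a set of finite measure is null; hence the exhaustion by intervals.
\<close>

lemma negligible_critical_values:
  fixes g :: "real \<Rightarrow> real"
  assumes g: "C-lipschitz_on UNIV g" and E: "E \<in> sets lebesgue"
    and crit: "\<And>x. x \<in> E \<Longrightarrow> (g has_real_derivative 0) (at x)"
  shows "negligible (g ` E)"
proof -
  define F where "F n = E \<inter> {- real n..real n}" for n :: nat
  have Fmeas: "F n \<in> sets lebesgue" for n using E by (auto simp: F_def)
  have Ffin: "emeasure lebesgue (F n) \<le> ennreal (2 * n)" for n
  proof -
    have "emeasure lebesgue (F n) \<le> emeasure lebesgue {- real n..real n}"
      by (intro emeasure_mono) (auto simp: F_def)
    then show ?thesis by simp
  qed
  have "emeasure lebesgue (g ` F n) \<le> 0 + ennreal e" if "0 < e" for n e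
  proof -
    define p where "p = e / (2 * n + 1)"
    have p: "0 < p" "p * (2 * n) \<le> e" using that by (auto simp: p_def field_simps)
    have "emeasure lebesgue (g ` F n) \<le> ennreal p * emeasure lebesgue (F n)"
    proof (rule emeasure_Lipschitz_image_le_of_fine_cover[OF g Fmeas])
      fix x d :: real assume x: "x \<in> F n" and d: "0 < d"
      have "(g has_derivative (\<lambda>h. 0)) (at x)"
        using crit[of x] x by (auto simp: F_def has_field_derivative_def lambda_zero)
      then obtain \<delta> where \<delta>: "0 < \<delta>" "\<And>y. \<bar>y - x\<bar> < \<delta> \<Longrightarrow> \<bar>g y - g x\<bar> \<le> p * \<bar>y - x\<bar>"
        unfolding has_derivative_at_alt using p(1) by auto
      define r where "r = min d \<delta> / 2"
      have r: "0 < r" "r < d" "r < \<delta>" using d \<delta>(1) by (auto simp: r_def)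
      have sub: "g ` cball x r \<subseteq> cball (g x) (p * r)"
      proof (rule image_subsetI)
        fix y assume y: "y \<in> cball x r"
        then have "\<bar>g y - g x\<bar> \<le> p * \<bar>y - x\<bar>"
          using r by (intro \<delta>(2)) (auto simp: dist_real_def)
        also have "\<dots> \<le> p * r" using y p(1) by (intro mult_left_mono) (auto simp: dist_real_def)
        finally show "g y \<in> cball (g x) (p * r)" by (simp add: dist_real_def)
      qed
      have "emeasure lebesgue (g ` cball x r) \<le> emeasure lebesgue (cball (g x) (p * r))"
        using sub by (intro emeasure_mono) auto
      also have "\<dots> = ennreal p * emeasure lebesgue (cball x r)"
        using p(1) r(1) by (simp add: cball_eq_atLeastAtMost ennreal_mult[symmetric] algebra_simps)
      finally show "\<exists>a r. 0 < r \<and> r < d \<and> x \<in> cball a r \<and>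
          emeasure lebesgue (g ` cball a r) \<le> ennreal p * emeasure lebesgue (cball a r)"
        using r by (intro exI[of _ x] exI[of _ r]) auto
    qed (use p in auto)
    also have "\<dots> \<le> ennreal p * ennreal (2 * n)" by (intro mult_left_mono Ffin) auto
    also have "\<dots> \<le> ennreal e" using p by (simp add: ennreal_mult[symmetric] ennreal_leI)
    finally show ?thesis by simp
  qed
  then have "emeasure lebesgue (g ` F n) \<le> 0" for n by (rule ennreal_le_epsilon)
  then have "negligible (g ` F n)" for n
    using sets_lebesgue_Lipschitz_image[OF g Fmeas[of n]] by (simp add: negligible_iff_null_sets null_sets_def)
  then have "negligible (\<Union>n. g ` F n)" by (rule negligible_Union_nat)
  moreover have "(\<Union>n. g ` F n) = g ` E"
    by (simp only: F_def image_UN[symmetric] UN_Int_symmetric_intervals)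
  ultimately show ?thesis by simp
qed

text \<open>
  For an increasing function the image of \<open>[a, b]\<close> has length \<open>v b - v a\<close>, so stretching is
  measured by difference quotients.
\<close>

lemma emeasure_mono_image_le:
  fixes v :: "real \<Rightarrow> real"
  assumes v: "C-lipschitz_on UNIV v" "mono v" and E: "E \<in> sets lebesgue" and p: "0 \<le> p"
    and slope: "\<And>x d. x \<in> E \<Longrightarrow> 0 < d \<Longrightarrow> \<exists>a b. a < x \<and> x < b \<and> b - a < d \<and> v b - v a \<le> p * (b - a)"
  shows "emeasure lebesgue (v ` E) \<le> ennreal p * emeasure lebesgue E"
proof (rule emeasure_Lipschitz_image_le_of_fine_cover[OF v(1) E p])
  fix x d :: real assume "x \<in> E" "0 < d"
  then obtain a b where ab: "a < x" "x < b" "b - a < d" "v b - v a \<le> p * (b - a)"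
    using slope by blast
  let ?c = "(a + b) / 2" and ?r = "(b - a) / 2"
  have cb: "cball ?c ?r = {a..b}" by (simp add: cball_eq_atLeastAtMost field_simps)
  have "emeasure lebesgue (v ` {a..b}) \<le> emeasure lebesgue {v a..v b}"
    using v(2) by (intro emeasure_mono) (auto simp: mono_def)
  also have "\<dots> = ennreal (v b - v a)" using v(2) ab by (simp add: mono_def)
  also have "\<dots> \<le> ennreal p * emeasure lebesgue {a..b}"
    using ab p by (simp add: ennreal_mult[symmetric] ennreal_leI)
  finally show "\<exists>a r. 0 < r \<and> r < d \<and> x \<in> cball a r \<and>
      emeasure lebesgue (v ` cball a r) \<le> ennreal p * emeasure lebesgue (cball a r)"
    using ab by (intro exI[of _ ?c] exI[of _ ?r]) (auto simp: cb)
qed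

text \<open>
  The reverse estimate is the previous one for the inverse function; the assumption on
  increments makes \<open>v\<close> a bijection of the line whose inverse is increasing and 1-Lipschitz.
\<close>

lemma emeasure_expanding_image_ge:
  fixes v :: "real \<Rightarrow> real"
  assumes v: "C-lipschitz_on UNIV v" and expand: "\<And>x y. x \<le> y \<Longrightarrow> y - x \<le> v y - v x"
    and E: "E \<in> sets lebesgue" and q: "0 < q"
    and slope: "\<And>x d. x \<in> E \<Longrightarrow> 0 < d \<Longrightarrow> \<exists>a b. a < x \<and> x < b \<and> b - a < d \<and> q * (b - a) \<le> v b - v a"
  shows "ennreal q * emeasure lebesgue E \<le> emeasure lebesgue (v ` E)"
proof -
  have less: "v x < v y" if "x < y" for x y using expand[of x y] that by auto
  have inj: "inj v"
  proof (rule injI)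
    fix x y assume "v x = v y"
    then show "x = y" using less[of x y] less[of y x] by (cases x y rule: linorder_cases) auto
  qed
  have surj: "\<exists>x. v x = y" for y
  proof -
    define t where "t = \<bar>y - v 0\<bar>"
    have "v (- t) \<le> y" using expand[of "- t" 0] by (auto simp: t_def)
    moreover have "y \<le> v t" using expand[of 0 t] by (auto simp: t_def)
    ultimately show ?thesis
      using IVT'[of v "- t" y t] lipschitz_on_continuous_on[OF v]
      by (auto simp: t_def intro: continuous_on_subset)
  qed
  define h where "h = inv v"
  have hv: "h (v x) = x" for x using inj by (simp add: h_def)
  have vh: "v (h y) = y" for y unfolding h_def using surj by (metis f_inv_into_f rangeI)
  have monoh: "mono h"
  proof (rule monoI)
    fix x y :: real assume "x \<le> y"
    then show "h x \<le> h y" using less[of "h y" "h x"] vh by (metis leD leI)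
  qed
  have "1-lipschitz_on UNIV h"
  proof (rule lipschitz_onI)
    fix x y :: real
    have "h s - h r \<le> s - r" if "r \<le> s" for r s
      using expand[of "h r" "h s"] monoh that by (simp add: vh mono_def)
    from this[of x y] this[of y x] show "dist (h x) (h y) \<le> 1 * dist x y"
      using monoD[OF monoh, of x y] monoD[OF monoh, of y x]
      by (cases "x \<le> y") (auto simp: dist_real_def)
  qed simp
  moreover have C: "0 \<le> C" using v lipschitz_on_nonneg by blast
  have "\<exists>a b. a < x \<and> x < b \<and> b - a < d \<and> h b - h a \<le> (1 / q) * (b - a)"
    if xE: "x \<in> v ` E" and d: "0 < d" for x d
  proof -
    from xE obtain x' where x': "x' \<in> E" "x = v x'" by auto
    obtain a b where ab: "a < x'" "x' < b" "b - a < d / (C + 1)" "q * (b - a) \<le> v b - v a"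
      using slope[OF x'(1), of "d / (C + 1)"] d C by auto
    have "v b - v a \<le> C * (b - a)"
      using lipschitz_onD[OF v, of b a] less[of a b] ab by (auto simp: dist_real_def)
    also have "\<dots> \<le> (C + 1) * (b - a)" using ab by (intro mult_right_mono) auto
    also have "\<dots> < d" using ab(3) C by (simp add: field_simps)
    finally show ?thesis
      using ab less q x' by (intro exI[of _ "v a"] exI[of _ "v b"]) (auto simp: hv field_simps)
  qed
  ultimately have "emeasure lebesgue (h ` v ` E) \<le> ennreal (1 / q) * emeasure lebesgue (v ` E)"
    using q monoh by (intro emeasure_mono_image_le sets_lebesgue_Lipschitz_image[OF v E]) auto
  moreover have "h ` v ` E = E" using hv by (auto simp: image_image)
  ultimately have "ennreal q * emeasure lebesgue E
      \<le> ennreal q * (ennreal (1 / q) * emeasure lebesgue (v ` E))"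
    by (intro mult_left_mono) auto
  also have "\<dots> = emeasure lebesgue (v ` E)"
    using q by (simp add: mult.assoc[symmetric] ennreal_mult[symmetric])
  finally show ?thesis .
qed

text \<open>
  Where \<open>v\<close> is not differentiable, difference quotients over small intervals around the point
  oscillate between two rational numbers \<open>p < q\<close>. On the set \<open>E\<close> of points with this property for a
  given pair, the two preceding lemmas give \<open>q |E| \<le> |v E| \<le> p |E|\<close>, hence \<open>|E| = 0\<close>.
\<close>

lemma negligible_expanding_not_differentiable:
  fixes v :: "real \<Rightarrow> real"
  assumes v: "C-lipschitz_on UNIV v" and expand: "\<And>x y. x \<le> y \<Longrightarrow> y - x \<le> v y - v x"
  shows "negligible {x. \<not> v differentiable (at x)}"
proof -
  (* Points with arbitrarily small surrounding intervals of slope above q, and below p. With x in the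
     open interval these sets are countable intersections of open sets. *)
  define S where "S q = {x. \<forall>n. \<exists>a b. a < x \<and> x < b \<and> b - a < 1 / Suc n \<and> q * (b - a) < v b - v a}"
    for q :: real
  define T where "T p = {x. \<forall>n. \<exists>a b. a < x \<and> x < b \<and> b - a < 1 / Suc n \<and> v b - v a < p * (b - a)}"
    for p :: real
  have gdelta: "{x. \<forall>n. \<exists>a b. a < x \<and> x < b \<and> b - a < 1 / Suc n \<and> P a b} \<in> sets lebesgue"
    for P :: "real \<Rightarrow> real \<Rightarrow> bool"
  proof -
    have "{x. \<forall>n. \<exists>a b. a < x \<and> x < b \<and> b - a < 1 / Suc n \<and> P a b} =
       (\<Inter>n. (\<Union>a. \<Union>b\<in>{b. b - a < 1 / Suc n \<and> P a b}. {a<..<b}))"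
    proof (rule set_eqI)
      fix x
      have "(\<exists>a b. a < x \<and> x < b \<and> b - a < 1 / Suc n \<and> P a b) \<longleftrightarrow>
          x \<in> (\<Union>a. \<Union>b\<in>{b. b - a < 1 / Suc n \<and> P a b}. {a<..<b})" for n
        by (auto simp del: of_nat_Suc)
      then show "x \<in> {x. \<forall>n. \<exists>a b. a < x \<and> x < b \<and> b - a < 1 / Suc n \<and> P a b} \<longleftrightarrow>
          x \<in> (\<Inter>n. (\<Union>a. \<Union>b\<in>{b. b - a < 1 / Suc n \<and> P a b}. {a<..<b}))"
        by simp
    qed
    also have "\<dots> \<in> sets borel"
      by (intro sets.countable_INT'' borel_open open_UN) auto
    finally show ?thesis by (simp add: in_borel_measurable_borel)
  qed
  have ex_n: "\<exists>n. 1 / Suc n < d" if "0 < d" for d :: real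
    using nat_approx_posE[OF that] by auto
  have null: "negligible (S q \<inter> T p)" if pq: "0 < p" "p < q" for p q
  proof -
    have "negligible (S q \<inter> T p \<inter> {- real n..real n})" (is "negligible ?E") for n
    proof -
      have E: "?E \<in> sets lebesgue" using gdelta by (auto simp: S_def T_def)
      have "mono v" using expand by (meson diff_ge_0_iff_ge monoI order_trans)
      have "emeasure lebesgue (v ` ?E) \<le> ennreal p * emeasure lebesgue ?E"
      proof (rule emeasure_mono_image_le[OF v \<open>mono v\<close> E])
        fix x d :: real assume x: "x \<in> ?E" and "0 < d"
        then obtain n where n: "1 / Suc n < d" using ex_n by blast
        have "x \<in> T p" using x by simp
        then obtain a b where "a < x" "x < b" "b - a < 1 / Suc n" "v b - v a < p * (b - a)"
          unfolding T_def by blast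
        then show "\<exists>a b. a < x \<and> x < b \<and> b - a < d \<and> v b - v a \<le> p * (b - a)"
          using n by (intro exI[of _ a] exI[of _ b]) auto
      qed (use pq in auto)
      moreover have "ennreal q * emeasure lebesgue ?E \<le> emeasure lebesgue (v ` ?E)"
      proof (rule emeasure_expanding_image_ge[OF v expand E])
        fix x d :: real assume x: "x \<in> ?E" and "0 < d"
        then obtain n where n: "1 / Suc n < d" using ex_n by blast
        have "x \<in> S q" using x by simp
        then obtain a b where "a < x" "x < b" "b - a < 1 / Suc n" "q * (b - a) < v b - v a"
          unfolding S_def by blast
        then show "\<exists>a b. a < x \<and> x < b \<and> b - a < d \<and> q * (b - a) \<le> v b - v a"
          using n by (intro exI[of _ a] exI[of _ b]) auto
      qed (use pq in auto)
      moreover obtain m where m: "emeasure lebesgue ?E = ennreal m" "0 \<le> m"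
      proof -
        have "emeasure lebesgue ?E \<le> emeasure lebesgue {- real n..real n}"
          by (intro emeasure_mono) auto
        also have "\<dots> < \<infinity>" by simp
        finally show ?thesis using that by (cases "emeasure lebesgue ?E") auto
      qed
      ultimately have "ennreal q * ennreal m \<le> ennreal p * ennreal m" by (metis order_trans)
      then have "q * m \<le> p * m"
        using pq m by (simp add: ennreal_mult[symmetric] ennreal_le_iff)
      then have "\<not> 0 < m" using pq by (simp add: mult_le_cancel_right)
      then have "m = 0" using m by simp
      then show ?thesis using m E by (simp add: negligible_iff_null_sets null_sets_def)
    qed
    then have "negligible (\<Union>n. S q \<inter> T p \<inter> {- real n..real n})"
      by (rule negligible_Union_nat)
    then show ?thesis by (simp only: UN_Int_symmetric_intervals)
  qed
  have "{x. \<not> v differentiable (at x)} \<subseteq> (\<Union>p\<in>\<rat> \<inter> {0<..}. \<Union>q\<in>\<rat> \<inter> {p<..}. S q \<inter> T p)"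
  proof (rule subsetI, rule ccontr)
    fix x assume nd: "x \<in> {x. \<not> v differentiable (at x)}"
      and "x \<notin> (\<Union>p\<in>\<rat> \<inter> {0<..}. \<Union>q\<in>\<rat> \<inter> {p<..}. S q \<inter> T p)"
    then have notST: "x \<notin> T p" if "x \<in> S q" "0 < p" "p < q" "p \<in> \<rat>" "q \<in> \<rat>" for p q
      using that by auto
    have Sdown: "x \<in> S q" if "x \<in> S q'" "q \<le> q'" for q q'
    proof -
      have "q * (b - a) < v b - v a" if "a < x" "x < b" "q' * (b - a) < v b - v a" for a b
        using that mult_right_mono[OF \<open>q \<le> q'\<close>, of "b - a"] by linarith
      then show ?thesis using \<open>x \<in> S q'\<close> unfolding S_def by blast
    qed
    (* All slopes are at least 1; so L is at least 1/2, and L - e is positive for e < 1/2. *)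
    have "x \<in> S (1/2)"
      unfolding S_def
    proof (intro CollectI allI)
      fix n :: nat
      define t where "t = 1 / real (Suc n)"
      have t: "0 < t" by (simp add: t_def)
      have "1/2 * (x + t/3 - (x - t/3)) < v (x + t/3) - v (x - t/3)"
        using expand[of "x - t/3" "x + t/3"] t by simp
      then show "\<exists>a b. a < x \<and> x < b \<and> b - a < 1 / Suc n \<and> 1/2 * (b - a) < v b - v a"
        unfolding t_def[symmetric] using t by (intro exI[of _ "x - t/3"] exI[of _ "x + t/3"]) auto
    qed
    have bound: "q \<le> C" if qS: "x \<in> S q" for q
    proof -
      obtain a b where ab: "a < x" "x < b" "q * (b - a) < v b - v a"
        using spec[OF CollectD[OF qS[unfolded S_def]], of 0] by blast
      have "v b - v a \<le> C * (b - a)"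
        using lipschitz_onD[OF v, of b a] ab by (auto simp: dist_real_def)
      then have "q * (b - a) < C * (b - a)" using ab by linarith
      then show ?thesis using ab by (auto simp: mult_less_cancel_right)
    qed
    (* The upper derivative at x, which is going to be the derivative. *)
    define L where "L = Sup {q. x \<in> S q}"
    have bdd: "bdd_above {q. x \<in> S q}" using bound by (auto simp: bdd_above_def)
    have L: "1/2 \<le> L" unfolding L_def using \<open>x \<in> S (1/2)\<close> by (intro cSup_upper bdd) auto
    have key: "\<exists>\<delta>>0. \<forall>a b. a < x \<longrightarrow> x < b \<longrightarrow> b - a < \<delta> \<longrightarrow>
        \<bar>v b - v a - L * (b - a)\<bar> \<le> e * (b - a)" if "0 < e" "e < 1/2" for e
    proof -
      have "x \<notin> S (L + e)"
        using cSup_upper[OF _ bdd, of "L + e"] \<open>0 < e\<close> by (auto simp: L_def)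
      then obtain n where n: "\<And>a b. a < x \<Longrightarrow> x < b \<Longrightarrow> b - a < 1 / Suc n \<Longrightarrow>
          v b - v a \<le> (L + e) * (b - a)"
        unfolding S_def mem_Collect_eq not_all by (meson not_less)
      obtain q where q: "x \<in> S q" "L - e < q"
        using less_cSupD[of "{q. x \<in> S q}" "L - e"] \<open>x \<in> S (1/2)\<close> \<open>0 < e\<close> by (auto simp: L_def)
      obtain p where p: "p \<in> \<rat>" "L - e < p" "p < q" using Rats_dense_in_real[OF q(2)] by auto
      obtain q' where q': "q' \<in> \<rat>" "p < q'" "q' < q" using Rats_dense_in_real[OF p(3)] by auto
      have "x \<notin> T p"
        using notST[of q' p] Sdown[OF q(1), of q'] p q' L that by auto
      then obtain m where m: "\<And>a b. a < x \<Longrightarrow> x < b \<Longrightarrow> b - a < 1 / Suc m \<Longrightarrow>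
          p * (b - a) \<le> v b - v a"
        unfolding T_def mem_Collect_eq not_all by (meson not_less)
      show ?thesis
      proof (intro exI[of _ "min (1 / Suc n) (1 / Suc m)"] conjI allI impI)
        fix a b assume ab: "a < x" "x < b" "b - a < min (1 / Suc n) (1 / Suc m)"
        have "(L - e) * (b - a) \<le> p * (b - a)" using p ab by (intro mult_right_mono) auto
        then show "\<bar>v b - v a - L * (b - a)\<bar> \<le> e * (b - a)"
          using m[of a b] n[of a b] ab by (auto simp: abs_le_iff algebra_simps)
      qed auto
    qed
    have cont: "continuous_on A v" for A
      using lipschitz_on_continuous_on[OF v] continuous_on_subset by blast
    have "(v has_derivative (\<lambda>h. L * h)) (at x)"
      unfolding has_derivative_at_alt
    proof (intro conjI allI impI bounded_linear_mult_right)
      fix e :: real assume "0 < e"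
      define e' where "e' = min e (1/3)"
      have e': "0 < e'" "e' < 1/2" "e' \<le> e" using \<open>0 < e\<close> by (auto simp: e'_def)
      from key[OF e'(1,2)] obtain \<delta> where \<delta>: "0 < \<delta>" "\<And>a b. a < x \<Longrightarrow> x < b \<Longrightarrow> b - a < \<delta> \<Longrightarrow>
        \<bar>v b - v a - L * (b - a)\<bar> \<le> e' * (b - a)" by blast
      have "\<bar>v y - v x - L * (y - x)\<bar> \<le> e' * \<bar>y - x\<bar>" if y: "\<bar>y - x\<bar> < \<delta>" for y
      proof -
        consider "y = x" | "x < y" | "y < x" by linarith
        then show ?thesis
        proof cases
          case 2
          (* The estimate holds on intervals with x in the interior; let the left end point tend to x. *)
          define \<eta> where "\<eta> = \<delta> - (y - x)"
          have "\<eta> > 0" using 2 y by (auto simp: \<eta>_def)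
          have "(\<lambda>a. \<bar>v y - v a - L * (y - a)\<bar> - e' * (y - a)) x \<le> 0"
          proof (rule continuous_le_on_closure[where S = "{x - \<eta><..<x}"
                and f = "\<lambda>a. \<bar>v y - v a - L * (y - a)\<bar> - e' * (y - a)"])
            show "x \<in> closure {x - \<eta><..<x}" using \<open>\<eta> > 0\<close> by simp
            show "\<bar>v y - v a - L * (y - a)\<bar> - e' * (y - a) \<le> 0" if "a \<in> {x - \<eta><..<x}" for a
              using \<delta>(2)[of a y] that 2 by (simp add: \<eta>_def)
          qed (intro continuous_intros cont)
          then show ?thesis using 2 by simp
        next
          case 3
          define \<eta> where "\<eta> = \<delta> - (x - y)"
          have "\<eta> > 0" using 3 y by (auto simp: \<eta>_def)
          have "(\<lambda>b. \<bar>v b - v y - L * (b - y)\<bar> - e' * (b - y)) x \<le> 0"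
          proof (rule continuous_le_on_closure[where S = "{x<..<x + \<eta>}"
                and f = "\<lambda>b. \<bar>v b - v y - L * (b - y)\<bar> - e' * (b - y)"])
            show "x \<in> closure {x<..<x + \<eta>}" using \<open>\<eta> > 0\<close> by simp
            show "\<bar>v b - v y - L * (b - y)\<bar> - e' * (b - y) \<le> 0" if "b \<in> {x<..<x + \<eta>}" for b
              using \<delta>(2)[of y b] that 3 by (simp add: \<eta>_def)
          qed (intro continuous_intros cont)
          moreover have "v y - v x - L * (y - x) = - (v x - v y - L * (x - y))"
            by (simp add: algebra_simps)
          ultimately show ?thesis using 3 by simp
        qed simp
      qed
      then have "\<bar>v y - v x - L * (y - x)\<bar> \<le> e * \<bar>y - x\<bar>" if "\<bar>y - x\<bar> < \<delta>" for y
        using that e' mult_right_mono[OF e'(3), of "\<bar>y - x\<bar>"] by (meson abs_ge_zero order_trans)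
      then show "\<exists>d>0. \<forall>y. norm (y - x) < d \<longrightarrow> norm (v y - v x - L * (y - x)) \<le> e * norm (y - x)"
        using \<delta>(1) by auto
    qed
    then show False using nd by (auto simp: differentiable_def)
  qed
  moreover have "negligible (\<Union>p\<in>\<rat> \<inter> {0<..}. \<Union>q\<in>\<rat> \<inter> {p<..}. S q \<inter> T p)"
  proof -
    have UN: "negligible (\<Union>q\<in>\<rat> \<inter> A. B q)" if "\<And>q. q \<in> A \<Longrightarrow> negligible (B q)" for A B
      using that countable_rat by (intro negligible_countable_Union countable_image countable_Int1) auto
    show ?thesis by (intro UN null) auto
  qed
  ultimately show ?thesis using negligible_subset by blast
qed

text \<open>
  Rademacher's theorem on the line: adding a linear function reduces it to the expanding case.
\<close>

lemma negligible_Lipschitz_not_differentiable: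
  fixes u :: "real \<Rightarrow> real"
  assumes u: "C-lipschitz_on UNIV u"
  shows "negligible {x. \<not> u differentiable (at x)}"
proof -
  define v where "v x = u x + (C + 1) * x" for x
  have C: "0 \<le> C" using u lipschitz_on_nonneg by blast
  have "(C + 1)-lipschitz_on UNIV (\<lambda>x. (C + 1) * x)"
    using C by (intro lipschitz_onI) (auto simp: dist_real_def right_diff_distrib[symmetric] abs_mult)
  with u have "(C + (C + 1))-lipschitz_on UNIV v"
    unfolding v_def by (rule lipschitz_on_add)
  moreover have "y - x \<le> v y - v x" if "x \<le> y" for x y
    using lipschitz_onD[OF u, of x y] that by (auto simp: v_def dist_real_def algebra_simps)
  ultimately have "negligible {x. \<not> v differentiable (at x)}"
    by (rule negligible_expanding_not_differentiable)
  moreover have "u differentiable (at x)" if "v differentiable (at x)" for x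
  proof -
    have "(\<lambda>x. v x - (C + 1) * x) differentiable (at x)"
      using that by (intro differentiable_diff derivative_intros) auto
    then show ?thesis by (simp add: v_def)
  qed
  ultimately show ?thesis by (auto elim!: negligible_subset)
qed

section \<open>The area formula\<close>

text \<open>
  McShane's formula: the infimum of the cones \<open>u y + C |x - y|\<close> with apex over a point \<open>y\<close> of \<open>S\<close>.
\<close>

lemma Lipschitz_extension:
  fixes u :: "real \<Rightarrow> real"
  assumes u: "C-lipschitz_on S u" and "S \<noteq> {}"
  obtains v where "C-lipschitz_on UNIV v" "\<And>x. x \<in> S \<Longrightarrow> v x = u x"
proof -
  have C: "0 \<le> C" using u lipschitz_on_nonneg by blast
  obtain z where z: "z \<in> S" using \<open>S \<noteq> {}\<close> by auto
  define A where "A x = (\<lambda>y. u y + C * \<bar>x - y\<bar>) ` S" for x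
  define v where "v x = Inf (A x)" for x
  have u_le: "u x \<le> u y + C * \<bar>x - y\<bar>" if "x \<in> S" "y \<in> S" for x y
    using lipschitz_onD[OF u that] by (auto simp: dist_real_def)
  have tri: "C * \<bar>x - z\<bar> \<le> C * \<bar>x - y\<bar> + C * \<bar>y - z\<bar>" for x y z
    using C mult_left_mono[of "\<bar>x - z\<bar>" "\<bar>x - y\<bar> + \<bar>y - z\<bar>" C] by (simp add: distrib_left)
  have bdd: "bdd_below (A x)" for x
  proof -
    have "u z - C * \<bar>z - x\<bar> \<le> u y + C * \<bar>x - y\<bar>" if "y \<in> S" for y
      using u_le[OF z that] tri[of z y x] by linarith
    then show ?thesis by (auto simp: A_def bdd_below_def)
  qed
  have ne: "A x \<noteq> {}" for x using \<open>S \<noteq> {}\<close> by (simp add: A_def)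
  have le: "v x \<le> v y + C * \<bar>x - y\<bar>" for x y
  proof -
    have "v x - C * \<bar>x - y\<bar> \<le> a" if "a \<in> A y" for a
    proof -
      from that obtain s where s: "s \<in> S" "a = u s + C * \<bar>y - s\<bar>" by (auto simp: A_def)
      have "v x \<le> u s + C * \<bar>x - s\<bar>" unfolding v_def using s by (intro cInf_lower bdd) (auto simp: A_def)
      then show ?thesis using tri[of x s y] s(2) by linarith
    qed
    then have "v x - C * \<bar>x - y\<bar> \<le> v y" unfolding v_def[of y] by (intro cInf_greatest ne) auto
    then show ?thesis by simp
  qed
  show ?thesis
  proof
    show "C-lipschitz_on UNIV v"
    proof (rule lipschitz_onI)
      show "dist (v x) (v y) \<le> C * dist x y" for x y
        using le[of x y] le[of y x] by (simp add: dist_real_def abs_le_iff abs_minus_commute)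
    qed (rule C)
    show "v x = u x" if "x \<in> S" for x
    proof (rule antisym)
      show "v x \<le> u x" unfolding v_def using that bdd by (intro cInf_lower) (auto simp: A_def image_iff intro!: bexI[of _ x])
      show "u x \<le> v x" unfolding v_def using that u_le by (intro cInf_greatest ne) (auto simp: A_def)
    qed
  qed
qed

text \<open>
  The value \<open>0\<close> at points without derivative puts them together with the critical points, so
  that \<open>deriv0 v x \<noteq> 0\<close> says that \<open>x\<close> is a regular point of \<open>v\<close>.
\<close>

definition deriv0 :: "(real \<Rightarrow> real) \<Rightarrow> real \<Rightarrow> real"
  where "deriv0 v x = (if v differentiable (at x) then deriv v x else 0)"

lemma has_real_derivative_deriv0: "v differentiable (at x) \<Longrightarrow> (v has_real_derivative deriv0 v x) (at x)"
  by (simp add: deriv0_def DERIV_deriv_iff_real_differentiable)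

lemma has_real_derivative_deriv0_nonzero: "deriv0 v x \<noteq> 0 \<Longrightarrow> (v has_real_derivative deriv0 v x) (at x)"
  by (rule has_real_derivative_deriv0) (auto simp: deriv0_def split: if_splits)

lemma abs_deriv0_le:
  assumes v: "C-lipschitz_on UNIV v"
  shows "\<bar>deriv0 v x\<bar> \<le> C"
proof (cases "v differentiable (at x)")
  case True
  have "((\<lambda>y. (v y - v x) / (y - x)) \<longlongrightarrow> deriv0 v x) (at x)"
    using has_real_derivative_deriv0[OF True] by (simp add: has_field_derivative_iff)
  then have "((\<lambda>y. \<bar>(v y - v x) / (y - x)\<bar>) \<longlongrightarrow> \<bar>deriv0 v x\<bar>) (at x)"
    by (rule tendsto_rabs)
  then show ?thesis
  proof (rule tendsto_upperbound)
    have "\<bar>(v y - v x) / (y - x)\<bar> \<le> C" if "y \<noteq> x" for y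
      using lipschitz_onD[OF v, of y x] that by (auto simp: dist_real_def abs_divide field_simps)
    then show "\<forall>\<^sub>F y in at x. \<bar>(v y - v x) / (y - x)\<bar> \<le> C"
      by (auto simp: eventually_at_filter)
  qed simp
qed (use lipschitz_on_nonneg[OF v] in \<open>simp add: deriv0_def\<close>)

lemma AE_has_real_derivative_deriv0:
  assumes "C-lipschitz_on UNIV v"
  shows "AE x in lebesgue. (v has_real_derivative deriv0 v x) (at x)"
  using negligible_Lipschitz_not_differentiable[OF assms] has_real_derivative_deriv0
  by (intro AE_I'[of "{x. \<not> v differentiable (at x)}"]) (auto simp: negligible_iff_null_sets)

text \<open>
  On the set of differentiability, which has a null complement, \<open>deriv0 v\<close> is a limit of difference
  quotients; elsewhere it is \<open>0\<close>.
\<close>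

lemma borel_measurable_deriv0:
  assumes v: "C-lipschitz_on UNIV v"
  shows "deriv0 v \<in> borel_measurable lebesgue"
proof -
  let ?D = "{x. v differentiable (at x)}"
  have "?D = space lebesgue - {x. \<not> v differentiable (at x)}" by auto
  then have D: "?D \<in> sets lebesgue"
    using negligible_imp_sets[OF negligible_Lipschitz_not_differentiable[OF v]]
    by (metis sets.compl_sets)
  have [measurable]: "v \<in> borel_measurable borel"
    using lipschitz_on_continuous_on[OF v] by (rule borel_measurable_continuous_onI)
  show ?thesis
  proof (rule borel_measurable_LIMSEQ_real)
    fix n :: nat
    have "(\<lambda>x. (v (x + 1 / Suc n) - v x) * Suc n) \<in> borel_measurable lborel"
      by measurable
    then show "(\<lambda>x. indicator ?D x * ((v (x + 1 / Suc n) - v x) * Suc n)) \<in> borel_measurable lebesgue"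
      using D by (intro borel_measurable_times measurable_completion borel_measurable_indicator) auto
  next
    fix x :: real
    show "(\<lambda>n. indicator ?D x * ((v (x + 1 / Suc n) - v x) * Suc n)) \<longlonglongrightarrow> deriv0 v x"
    proof (cases "v differentiable (at x)")
      case True
      have "((\<lambda>h. (v (x + h) - v x) / h) \<longlongrightarrow> deriv0 v x) (at 0)"
        using has_real_derivative_deriv0[OF True] by (simp add: DERIV_def)
      moreover have "filterlim (\<lambda>n. 1 / real (Suc n)) (at 0) sequentially"
        using LIMSEQ_Suc[OF lim_1_over_n] by (intro filterlim_atI) auto
      ultimately have "(\<lambda>n. (v (x + 1 / Suc n) - v x) / (1 / Suc n)) \<longlonglongrightarrow> deriv0 v x"
        by (rule filterlim_compose)
      then show ?thesis using True by simp
    qed (simp add: deriv0_def)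
  qed
qed

text \<open>
  At a regular point \<open>v\<close> separates the point from all others within some distance \<open>1 / (n + 1)\<close>, at
  a definite rate. Fixing \<open>n\<close> and cutting the line into intervals of that length makes \<open>v\<close> injective on
  each piece.
\<close>

lemma regular_set_decomposition:
  assumes v: "C-lipschitz_on UNIV v"
  obtains S :: "nat \<Rightarrow> real set"
  where "\<And>k. S k \<in> sets lebesgue" "\<And>k. bounded (S k)" "\<And>k. inj_on v (S k)"
    "disjoint_family S" "(\<Union>k. S k) = {x. deriv0 v x \<noteq> 0}"
proof -
  let ?R = "{x. deriv0 v x \<noteq> 0}"
  (* A strict bound on the distance and a non-strict conclusion make this set closed. *)
  define P where "P n = {x. \<forall>y. \<bar>y - x\<bar> < 1 / Suc n \<longrightarrow> \<bar>y - x\<bar> / Suc n \<le> \<bar>v y - v x\<bar>}" for n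
  have cont: "continuous_on A v" for A
    using lipschitz_on_continuous_on[OF v] continuous_on_subset by blast
  have closedP: "closed (P n)" for n
  proof -
    have "closed {x. \<bar>y - x\<bar> < 1 / Suc n \<longrightarrow> \<bar>y - x\<bar> / Suc n \<le> \<bar>v y - v x\<bar>}" for y
    proof -
      have "{x. \<bar>y - x\<bar> < 1 / Suc n \<longrightarrow> \<bar>y - x\<bar> / Suc n \<le> \<bar>v y - v x\<bar>} =
        {x. 1 / Suc n \<le> \<bar>y - x\<bar>} \<union> {x. \<bar>y - x\<bar> / Suc n \<le> \<bar>v y - v x\<bar>}"
        by auto
      then show ?thesis
        by (simp only:) (intro closed_Un closed_Collect_le continuous_intros cont; simp)
    qed
    then have "closed (\<Inter>y. {x. \<bar>y - x\<bar> < 1 / Suc n \<longrightarrow> \<bar>y - x\<bar> / Suc n \<le> \<bar>v y - v x\<bar>})"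
      by (intro closed_INT) auto
    moreover have "(\<Inter>y. {x. \<bar>y - x\<bar> < 1 / Suc n \<longrightarrow> \<bar>y - x\<bar> / Suc n \<le> \<bar>v y - v x\<bar>}) = P n"
      by (auto simp: P_def)
    ultimately show ?thesis by simp
  qed
  define B where "B n j = {real_of_int j / Suc n..<real_of_int (j + 1) / Suc n}" for n and j :: int
  define T where "T k = (case from_nat k of (n, j) \<Rightarrow> ?R \<inter> P n \<inter> B n j)" for k
  have Rmeas: "?R \<in> sets lebesgue"
    using measurable_sets[OF borel_measurable_deriv0[OF v], of "- {0}"] by (simp add: vimage_def)
  have "T k \<in> sets lebesgue" for k
    unfolding T_def B_def using Rmeas closedP by (auto split: prod.split intro!: sets.Int)
  then have Tmeas: "range (disjointed T) \<subseteq> sets lebesgue"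
    by (intro sets.range_disjointed_sets) auto
  have Tbdd: "bounded (T k)" for k
  proof -
    obtain n :: nat and j :: int where nj: "from_nat k = (n, j)"
      by (cases "from_nat k :: nat \<times> int") auto
    have "T k \<subseteq> {real_of_int j / Suc n..real_of_int (j + 1) / Suc n}"
      by (auto simp: T_def nj B_def)
    then show ?thesis by (rule bounded_subset[OF bounded_closed_interval])
  qed
  have Tinj: "inj_on v (T k)" for k
  proof (rule inj_onI, rule ccontr)
    fix x y assume xy: "x \<in> T k" "y \<in> T k" "v x = v y" "x \<noteq> y"
    obtain n :: nat and j :: int where nj: "from_nat k = (n, j)"
      by (cases "from_nat k :: nat \<times> int") auto
    have "x \<in> B n j" "y \<in> B n j" "x \<in> P n" using xy nj by (auto simp: T_def)
    moreover from this(1,2) have "\<bar>y - x\<bar> < real_of_int (j + 1) / Suc n - real_of_int j / Suc n"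
      by (auto simp: B_def)
    moreover have "real_of_int (j + 1) / Suc n - real_of_int j / Suc n = 1 / Suc n"
      by (simp add: diff_divide_distrib[symmetric])
    ultimately have "\<bar>y - x\<bar> / Suc n \<le> \<bar>v y - v x\<bar>" by (simp add: P_def)
    moreover have "0 < \<bar>y - x\<bar> / Suc n" using xy(4) by simp
    ultimately show False using xy(3) by simp
  qed
  have "x \<in> (\<Union>k. T k)" if x: "deriv0 v x \<noteq> 0" for x
  proof -
    let ?l = "deriv0 v x"
    have "(v has_derivative (\<lambda>h. ?l * h)) (at x)"
      using has_real_derivative_deriv0_nonzero[OF x] by (simp add: has_field_derivative_def)
    then obtain d where d: "0 < d" "\<And>y. \<bar>y - x\<bar> < d \<Longrightarrow> \<bar>v y - v x - ?l * (y - x)\<bar> \<le> \<bar>?l\<bar> / 2 * \<bar>y - x\<bar>"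
      unfolding has_derivative_at_alt real_norm_def using x
      by (meson half_gt_zero zero_less_abs_iff)
    have "0 < min d (\<bar>?l\<bar> / 2)" using x d(1) by simp
    then obtain n where n: "1 / Suc n < min d (\<bar>?l\<bar> / 2)" using nat_approx_posE by blast
    have "x \<in> P n"
      unfolding P_def
    proof (intro CollectI allI impI)
      fix y assume y: "\<bar>y - x\<bar> < 1 / Suc n"
      have "\<bar>?l\<bar> * \<bar>y - x\<bar> - \<bar>?l\<bar> / 2 * \<bar>y - x\<bar> \<le> \<bar>v y - v x\<bar>"
        using d(2)[of y] n y abs_mult[of ?l "y - x"] by linarith
      moreover have "1 / Suc n * \<bar>y - x\<bar> \<le> \<bar>?l\<bar> / 2 * \<bar>y - x\<bar>"
        using n by (intro mult_right_mono) auto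
      moreover have "\<bar>y - x\<bar> / Suc n = 1 / Suc n * \<bar>y - x\<bar>" by simp
      ultimately show "\<bar>y - x\<bar> / Suc n \<le> \<bar>v y - v x\<bar>" by linarith
    qed
    moreover define j where "j = \<lfloor>x * Suc n\<rfloor>"
    have "x \<in> B n j"
    proof -
      have "real_of_int j \<le> x * Suc n" "x * Suc n < real_of_int (j + 1)"
        unfolding j_def by (simp_all only: of_int_floor_le) linarith
      then show ?thesis by (simp add: B_def field_simps)
    qed
    ultimately have "x \<in> T (to_nat (n, j))" using x by (simp add: T_def)
    then show ?thesis by blast
  qed
  moreover have "deriv0 v x \<noteq> 0" if "x \<in> T k" for x k
    using that by (auto simp: T_def split: prod.splits)
  ultimately have UT: "(\<Union>k. T k) = ?R" by auto
  show ?thesis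
  proof
    show "disjointed T k \<in> sets lebesgue" for k using Tmeas by auto
    show "bounded (disjointed T k)" for k using Tbdd disjointed_subset bounded_subset by metis
    show "inj_on v (disjointed T k)" for k using Tinj disjointed_subset inj_on_subset by metis
    show "disjoint_family (disjointed T)" by (rule disjoint_family_disjointed)
    show "(\<Union>k. disjointed T k) = ?R" using UT by (simp add: UN_disjointed_eq)
  qed
qed

lemma emeasure_inj_Lipschitz_image:
  assumes v: "C-lipschitz_on UNIV v" and E: "E \<in> sets lebesgue" "bounded E" "inj_on v E"
    and reg: "\<And>x. x \<in> E \<Longrightarrow> deriv0 v x \<noteq> 0"
  shows "emeasure lebesgue (v ` E) = (\<integral>\<^sup>+x. ennreal \<bar>deriv0 v x\<bar> * indicator E x \<partial>lebesgue)"
proof -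
  have Efin: "E \<in> lmeasurable" using E by (intro bounded_set_imp_lmeasurable)
  have der: "(v has_field_derivative deriv0 v x) (at x within E)" if "x \<in> E" for x
    using has_real_derivative_deriv0_nonzero[OF reg[OF that]] by (rule has_field_derivative_at_within)
  have absint: "(\<lambda>x. \<bar>deriv0 v x\<bar>) absolutely_integrable_on E"
  proof (rule measurable_bounded_by_integrable_imp_absolutely_integrable)
    show "(\<lambda>x. \<bar>deriv0 v x\<bar>) \<in> borel_measurable (lebesgue_on E)"
      using borel_measurable_deriv0[OF v] by (intro borel_measurable_abs measurable_restrict_space1)
    show "(\<lambda>x. C) integrable_on E" using Efin by (rule integrable_on_const)
  qed (use E abs_deriv0_le[OF v] in auto)
  note cov = has_absolute_integral_change_of_variables_1'[OF E(1) der E(3), where f = "\<lambda>_. 1", simplified]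
  have "(\<lambda>_. 1 :: real) absolutely_integrable_on v ` E \<and>
      integral (v ` E) (\<lambda>_. 1 :: real) = integral E (\<lambda>x. \<bar>deriv0 v x\<bar>)"
    using absint cov by blast
  then have vE: "v ` E \<in> lmeasurable" "measure lebesgue (v ` E) = integral E (\<lambda>x. \<bar>deriv0 v x\<bar>)"
    by (auto simp: lmeasurable_iff_integrable_on lmeasure_integral absolutely_integrable_on_def)
  have "((\<lambda>x. \<bar>deriv0 v x\<bar>) has_integral integral E (\<lambda>x. \<bar>deriv0 v x\<bar>)) E"
    using absint by (simp add: absolutely_integrable_on_def integrable_integral)
  then have "(\<integral>\<^sup>+x. ennreal \<bar>deriv0 v x\<bar> * indicator E x \<partial>lborel) = ennreal (integral E (\<lambda>x. \<bar>deriv0 v x\<bar>))"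
    by (intro nn_integral_has_integral_lebesgue') auto
  then have "(\<integral>\<^sup>+x. ennreal \<bar>deriv0 v x\<bar> * indicator E x \<partial>lebesgue) = ennreal (measure lebesgue (v ` E))"
    unfolding vE(2) nn_integral_completion .
  also have "\<dots> = emeasure lebesgue (v ` E)"
    using vE(1) by (intro emeasure_eq_measure2[symmetric]) auto
  finally show ?thesis by simp
qed

text \<open>
  For the indicator of a set, both sides are sums over the injective pieces, on which the formula is the
  change of variables for the measure of an image. The general case follows by linearity and
  monotone convergence, which hold for the inner integral because every function is measurable for
  counting measure. Multiplication by \<open>|deriv0 v x|\<close> restricts the left-hand side to regular points.
\<close>

lemma area_formula:
  assumes v: "C-lipschitz_on UNIV v" and h: "h \<in> borel_measurable lebesgue"
  shows "(\<lambda>c. \<integral>\<^sup>+x. h x \<partial>count_space {x. deriv0 v x \<noteq> 0 \<and> v x = c}) \<in> borel_measurable lebesgue \<and>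
    (\<integral>\<^sup>+x. h x * ennreal \<bar>deriv0 v x\<bar> \<partial>lebesgue) =
    (\<integral>\<^sup>+c. (\<integral>\<^sup>+x. h x \<partial>count_space {x. deriv0 v x \<noteq> 0 \<and> v x = c}) \<partial>lebesgue)"
    (is "?P h")
proof -
  let ?N = "\<lambda>c. {x. deriv0 v x \<noteq> 0 \<and> v x = c}"
  have d[measurable]: "(\<lambda>x. ennreal \<bar>deriv0 v x\<bar>) \<in> borel_measurable lebesgue"
    using borel_measurable_deriv0[OF v] by measurable
  obtain S :: "nat \<Rightarrow> real set" where S: "\<And>k. S k \<in> sets lebesgue" "\<And>k. bounded (S k)" "\<And>k. inj_on v (S k)"
    "disjoint_family S" "(\<Union>k. S k) = {x. deriv0 v x \<noteq> 0}"
    using regular_set_decomposition[OF v] by metis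
  from h show ?thesis
  proof (induction rule: borel_measurable_induct)
    case (cong f g)
    then have "f = g" by auto
    with cong show ?case by simp
  next
    case (set A)
    let ?A = "\<lambda>k. A \<inter> S k"
    have Am: "?A k \<in> sets lebesgue" for k using set S by auto
    have vA: "v ` ?A k \<in> sets lebesgue" for k by (intro sets_lebesgue_Lipschitz_image[OF v] Am)
    have cnt: "(\<integral>\<^sup>+x. indicator A x \<partial>count_space (?N c)) = (\<Sum>k. indicator (v ` ?A k) c)" for c
    proof -
      have sub: "?A k \<inter> ?N c \<subseteq> ?N c" for k by auto
      have AN: "A \<inter> ?N c = (\<Union>k. ?A k \<inter> ?N c)" using S(5) by auto
      have "(\<integral>\<^sup>+x. indicator A x \<partial>count_space (?N c)) = emeasure (count_space (?N c)) (A \<inter> ?N c)"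
      proof -
        have "(\<integral>\<^sup>+x. indicator A x \<partial>count_space (?N c)) =
            (\<integral>\<^sup>+x. indicator (A \<inter> ?N c) x \<partial>count_space (?N c))"
          by (intro nn_integral_cong) (auto simp: indicator_def)
        also have "\<dots> = emeasure (count_space (?N c)) (A \<inter> ?N c)"
          by (intro nn_integral_indicator) auto
        finally show ?thesis .
      qed
      also have "\<dots> = (\<Sum>k. emeasure (count_space (?N c)) (?A k \<inter> ?N c))"
        unfolding AN using S(4)
        by (intro suminf_emeasure[symmetric]) (auto simp: disjoint_family_on_def)
      also have "\<dots> = (\<Sum>k. indicator (v ` ?A k) c)"
      proof (intro suminf_cong)
        fix k
        show "emeasure (count_space (?N c)) (?A k \<inter> ?N c) = indicator (v ` ?A k) c"
        proof (cases "c \<in> v ` ?A k")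
          case True
          then obtain x where x: "x \<in> ?A k" "v x = c" by auto
          have "?A k \<inter> ?N c = {x}"
            using x S(3)[of k] S(5) by (auto simp: inj_on_def)
          moreover have "x \<in> ?N c" using x S(5) by auto
          ultimately show ?thesis using True by simp
        next
          case False
          then have "?A k \<inter> ?N c = {}" by auto
          then show ?thesis using False by simp
        qed
      qed
      finally show ?thesis .
    qed
    have vm: "(\<lambda>c. indicator (v ` ?A k) c :: ennreal) \<in> borel_measurable lebesgue" for k
      using vA by simp
    have split: "indicator A x * ennreal \<bar>deriv0 v x\<bar> = (\<Sum>k. ennreal \<bar>deriv0 v x\<bar> * indicator (?A k) x)" for x
    proof -
      have "(\<Sum>k. ennreal \<bar>deriv0 v x\<bar> * indicator (?A k) x) =
          ennreal \<bar>deriv0 v x\<bar> * (\<Sum>k. indicator (?A k) x)" by simp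
      also have "(\<Sum>k. indicator (?A k) x :: ennreal) = indicator (\<Union>k. ?A k) x"
        using S(4) by (intro suminf_indicator) (auto simp: disjoint_family_on_def)
      also have "ennreal \<bar>deriv0 v x\<bar> * indicator (\<Union>k. ?A k) x = indicator A x * ennreal \<bar>deriv0 v x\<bar>"
        using S(5) by (auto split: split_indicator)
      finally show ?thesis by simp
    qed
    have "(\<integral>\<^sup>+x. indicator A x * ennreal \<bar>deriv0 v x\<bar> \<partial>lebesgue) =
        (\<Sum>k. \<integral>\<^sup>+x. ennreal \<bar>deriv0 v x\<bar> * indicator (?A k) x \<partial>lebesgue)"
      unfolding split using Am by (intro nn_integral_suminf) auto
    also have "\<dots> = (\<Sum>k. emeasure lebesgue (v ` ?A k))"
    proof (intro suminf_cong emeasure_inj_Lipschitz_image[OF v, symmetric] Am)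
      fix k
      show "bounded (?A k)" using S(2) bounded_subset by blast
      show "inj_on v (?A k)" using S(3) by (rule inj_on_subset) auto
      show "deriv0 v x \<noteq> 0" if "x \<in> ?A k" for x using that S(5) by auto
    qed
    also have "\<dots> = (\<integral>\<^sup>+c. (\<Sum>k. indicator (v ` ?A k) c) \<partial>lebesgue)"
      using vA by (subst nn_integral_suminf) auto
    finally show ?case
      unfolding cnt using vm by (auto intro!: borel_measurable_suminf_order)
  next
    case (mult f a)
    then have "(\<lambda>c. a * (\<integral>\<^sup>+x. f x \<partial>count_space (?N c))) \<in> borel_measurable lebesgue"
      by (intro borel_measurable_times_ennreal) auto
    with mult show ?case
      by (simp add: nn_integral_cmult mult.assoc)
  next
    case (add f g)
    then have "(\<lambda>c. (\<integral>\<^sup>+x. g x \<partial>count_space (?N c)) + (\<integral>\<^sup>+x. f x \<partial>count_space (?N c)))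
        \<in> borel_measurable lebesgue"
      by (intro borel_measurable_add) auto
    with add show ?case
      by (simp add: nn_integral_add distrib_right)
  next
    case (seq U)
    have "(\<integral>\<^sup>+x. (SUP i. U i) x \<partial>count_space (?N c)) = (SUP i. \<integral>\<^sup>+x. U i x \<partial>count_space (?N c))" for c
      using seq(3) by (simp add: nn_integral_monotone_convergence_SUP image_comp)
    moreover have "(\<integral>\<^sup>+x. (SUP i. U i) x * ennreal \<bar>deriv0 v x\<bar> \<partial>lebesgue) =
        (SUP i. \<integral>\<^sup>+x. U i x * ennreal \<bar>deriv0 v x\<bar> \<partial>lebesgue)"
    proof -
      have "(SUP i. U i) x * ennreal \<bar>deriv0 v x\<bar> = (SUP i. U i x * ennreal \<bar>deriv0 v x\<bar>)" for x
        by (simp add: SUP_mult_right_ennreal image_comp)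
      moreover have "incseq (\<lambda>i x. U i x * ennreal \<bar>deriv0 v x\<bar>)"
        using seq(3) by (auto simp: incseq_def le_fun_def intro!: mult_right_mono)
      ultimately show ?thesis
        using seq(1) by (simp add: nn_integral_monotone_convergence_SUP)
    qed
    moreover have "incseq (\<lambda>i c. \<integral>\<^sup>+x. U i x \<partial>count_space (?N c))"
      using seq(3) by (auto simp: incseq_def le_fun_def intro!: nn_integral_mono)
    moreover have "\<And>i. (\<lambda>c. \<integral>\<^sup>+x. U i x \<partial>count_space (?N c)) \<in> borel_measurable lebesgue"
      and "\<And>i. (\<integral>\<^sup>+x. U i x * ennreal \<bar>deriv0 v x\<bar> \<partial>lebesgue) =
        (\<integral>\<^sup>+c. (\<integral>\<^sup>+x. U i x \<partial>count_space (?N c)) \<partial>lebesgue)"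
      using seq.IH by auto
    ultimately show ?case
      by (simp only: nn_integral_monotone_convergence_SUP) (auto intro!: borel_measurable_SUP)
  qed
qed

section \<open>Level sets over regular values\<close>

lemma negligible_Borel_superset:
  assumes "negligible (N :: real set)"
  obtains Z where "Z \<in> sets borel" "N \<subseteq> Z" "negligible Z"
proof -
  have "N \<in> null_sets (completion lborel)" using assms by (simp add: negligible_iff_null_sets)
  then obtain Z where Z: "Z \<in> null_sets lborel" "N \<subseteq> Z"
    unfolding null_sets_completion_iff2 by blast
  then have "negligible Z"
    unfolding negligible_iff_null_sets by (intro null_sets_completionI)
  then show ?thesis using Z that by auto
qed

lemma borel_measurable_Lipschitz:
  fixes v :: "real \<Rightarrow> real"
  shows "C-lipschitz_on UNIV v \<Longrightarrow> v \<in> borel_measurable borel"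
  by (rule borel_measurable_continuous_onI[OF lipschitz_on_continuous_on])

lemma vimage_Lipschitz_lebesgue:
  fixes v :: "real \<Rightarrow> real"
  assumes v: "C-lipschitz_on UNIV v" and B: "B \<in> sets borel"
  shows "v -` B \<in> sets lebesgue"
  using measurable_sets[OF borel_measurable_Lipschitz[OF v] B] by simp

text \<open>
  The area formula for the indicator of \<open>v -` Z\<close> integrates \<open>|v'|\<close> over that set and yields an integral
  over \<open>Z\<close>, which vanishes.
\<close>

lemma AE_critical_on_null_preimage:
  assumes v: "C-lipschitz_on UNIV v" and Z: "Z \<in> sets borel" "negligible Z"
  shows "AE x in lebesgue. v x \<in> Z \<longrightarrow> deriv0 v x = 0"
proof -
  let ?h = "indicator (v -` Z) :: real \<Rightarrow> ennreal"
  let ?N = "\<lambda>c. {x. deriv0 v x \<noteq> 0 \<and> v x = c}"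
  have h[measurable]: "?h \<in> borel_measurable lebesgue"
    using vimage_Lipschitz_lebesgue[OF v Z(1)] by simp
  have d[measurable]: "deriv0 v \<in> borel_measurable lebesgue" by (rule borel_measurable_deriv0[OF v])
  have "AE c in lebesgue. c \<notin> Z"
    using Z(2) by (auto simp: negligible_iff_null_sets intro: AE_not_in)
  then have "AE c in lebesgue. (\<integral>\<^sup>+x. ?h x \<partial>count_space (?N c)) = 0"
  proof (rule AE_mp, intro AE_I2 impI)
    fix c assume "c \<notin> Z"
    then have "(\<integral>\<^sup>+x. ?h x \<partial>count_space (?N c)) = (\<integral>\<^sup>+x. 0 \<partial>count_space (?N c))"
      by (intro nn_integral_cong) (auto simp: indicator_def)
    then show "(\<integral>\<^sup>+x. ?h x \<partial>count_space (?N c)) = 0" by simp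
  qed
  then have "(\<integral>\<^sup>+c. (\<integral>\<^sup>+x. ?h x \<partial>count_space (?N c)) \<partial>lebesgue) = 0"
    using area_formula[OF v h] by (subst nn_integral_0_iff_AE) auto
  then have "(\<integral>\<^sup>+x. ?h x * ennreal \<bar>deriv0 v x\<bar> \<partial>lebesgue) = 0"
    using area_formula[OF v h] by simp
  then have "AE x in lebesgue. ?h x * ennreal \<bar>deriv0 v x\<bar> = 0"
    by (subst (asm) nn_integral_0_iff_AE) auto
  then show ?thesis by (rule AE_mp) (auto simp: indicator_def intro!: AE_I2)
qed

text \<open>
  The area formula for \<open>h / |v'|\<close>, restricted to points whose value lies off a set \<open>Z\<close> that
  contains the critical values; all points of a level set over \<open>- Z\<close> are regular.
\<close>

lemma coarea_off_critical_values:
  assumes v: "C-lipschitz_on UNIV v" and I: "I \<in> sets lebesgue" and Z: "Z \<in> sets borel"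
    and crit: "\<And>x. x \<in> I \<Longrightarrow> deriv0 v x = 0 \<Longrightarrow> v x \<in> Z"
    and h: "h \<in> borel_measurable lebesgue"
  shows "(\<lambda>c. indicator (- Z) c * (\<integral>\<^sup>+x. h x * ennreal (1 / \<bar>deriv0 v x\<bar>) \<partial>count_space {x \<in> I. v x = c}))
      \<in> borel_measurable lebesgue" (is "?g \<in> _")
    and "(\<integral>\<^sup>+x. h x * indicator {x \<in> I. v x \<notin> Z} x \<partial>lebesgue) =
      (\<integral>\<^sup>+c. indicator (- Z) c * (\<integral>\<^sup>+x. h x * ennreal (1 / \<bar>deriv0 v x\<bar>) \<partial>count_space {x \<in> I. v x = c}) \<partial>lebesgue)"
proof -
  let ?N = "\<lambda>c. {x. deriv0 v x \<noteq> 0 \<and> v x = c}"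
  let ?A = "{x \<in> I. v x \<notin> Z}"
  let ?h = "\<lambda>x. h x * ennreal (1 / \<bar>deriv0 v x\<bar>) * indicator ?A x"
  note h[measurable]
  have d[measurable]: "deriv0 v \<in> borel_measurable lebesgue" by (rule borel_measurable_deriv0[OF v])
  have "?A = I - v -` Z" by auto
  then have [measurable]: "?A \<in> sets lebesgue"
    using I vimage_Lipschitz_lebesgue[OF v Z] by auto
  have h': "?h \<in> borel_measurable lebesgue" by measurable
  have inner: "(\<integral>\<^sup>+x. ?h x \<partial>count_space (?N c)) = ?g c" for c
  proof (cases "c \<in> Z")
    case True
    then have "(\<integral>\<^sup>+x. ?h x \<partial>count_space (?N c)) = (\<integral>\<^sup>+x. 0 \<partial>count_space (?N c))"
      by (intro nn_integral_cong) (auto simp: indicator_def)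
    then show ?thesis using True by simp
  next
    case False
    then have "(\<integral>\<^sup>+x. ?h x \<partial>count_space (?N c)) = (\<integral>\<^sup>+x. ?h x \<partial>count_space {x \<in> I. v x = c})"
      using crit by (intro nn_integral_count_space_eq) (auto simp: indicator_def)
    also have "\<dots> = (\<integral>\<^sup>+x. h x * ennreal (1 / \<bar>deriv0 v x\<bar>) \<partial>count_space {x \<in> I. v x = c})"
      using False by (intro nn_integral_cong) (auto simp: indicator_def)
    finally show ?thesis using False by simp
  qed
  show "?g \<in> borel_measurable lebesgue"
    using area_formula[OF v h'] by (simp only: inner)
  have "(\<integral>\<^sup>+x. h x * indicator ?A x \<partial>lebesgue) = (\<integral>\<^sup>+x. ?h x * ennreal \<bar>deriv0 v x\<bar> \<partial>lebesgue)"
  proof (intro nn_integral_cong)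
    fix x
    show "h x * indicator ?A x = ?h x * ennreal \<bar>deriv0 v x\<bar>"
    proof (cases "x \<in> ?A")
      case True
      then have "deriv0 v x \<noteq> 0" using crit by auto
      then have "ennreal (1 / \<bar>deriv0 v x\<bar>) * ennreal \<bar>deriv0 v x\<bar> = 1"
        by (simp add: ennreal_mult[symmetric])
      then show ?thesis using True by (simp add: mult.assoc)
    qed simp
  qed
  also have "\<dots> = (\<integral>\<^sup>+c. ?g c \<partial>lebesgue)"
    using area_formula[OF v h'] by (simp only: inner)
  finally show "(\<integral>\<^sup>+x. h x * indicator ?A x \<partial>lebesgue) = (\<integral>\<^sup>+c. ?g c \<partial>lebesgue)" .
qed

text \<open>
  The number of points on a level is integrable over \<open>- Z\<close>, its integral being that of \<open>|v'|\<close> over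
  the points whose value lies off \<open>Z\<close>, a set of finite measure on which \<open>|v'|\<close> is bounded.
\<close>

lemma AE_finite_level_sets:
  assumes v: "C-lipschitz_on UNIV v" and I: "I \<in> sets lebesgue" and Z: "Z \<in> sets borel"
    and crit: "\<And>x. x \<in> I \<Longrightarrow> deriv0 v x = 0 \<Longrightarrow> v x \<in> Z"
    and fin: "emeasure lebesgue {x \<in> I. v x \<notin> Z} < \<infinity>"
  shows "AE c in lebesgue. c \<notin> Z \<longrightarrow> finite {x \<in> I. v x = c}"
proof -
  let ?h = "\<lambda>x. ennreal \<bar>deriv0 v x\<bar>"
  let ?A = "{x \<in> I. v x \<notin> Z}"
  have [measurable]: "deriv0 v \<in> borel_measurable lebesgue" by (rule borel_measurable_deriv0[OF v])
  have h: "?h \<in> borel_measurable lebesgue" by measurable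
  have "?A = I - v -` Z" by auto
  then have A: "?A \<in> sets lebesgue"
    using I vimage_Lipschitz_lebesgue[OF v Z] by auto
  note co = coarea_off_critical_values[OF v I Z crit h]
  have "(\<integral>\<^sup>+c. indicator (- Z) c * (\<integral>\<^sup>+x. ?h x * ennreal (1 / \<bar>deriv0 v x\<bar>) \<partial>count_space {x \<in> I. v x = c}) \<partial>lebesgue) =
      (\<integral>\<^sup>+x. ?h x * indicator ?A x \<partial>lebesgue)"
    by (rule co(2)[symmetric])
  also have "\<dots> \<le> (\<integral>\<^sup>+x. ennreal C * indicator ?A x \<partial>lebesgue)"
    using abs_deriv0_le[OF v] by (intro nn_integral_mono mult_right_mono) (auto intro: ennreal_leI)
  also have "\<dots> = ennreal C * emeasure lebesgue ?A" using A by (rule nn_integral_cmult_indicator)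
  also have "\<dots> < \<infinity>" using fin by (simp add: ennreal_mult_less_top)
  finally have "(\<integral>\<^sup>+c. indicator (- Z) c * (\<integral>\<^sup>+x. ?h x * ennreal (1 / \<bar>deriv0 v x\<bar>) \<partial>count_space {x \<in> I. v x = c}) \<partial>lebesgue) \<noteq> \<infinity>"
    by simp
  then have "AE c in lebesgue. indicator (- Z) c * (\<integral>\<^sup>+x. ?h x * ennreal (1 / \<bar>deriv0 v x\<bar>) \<partial>count_space {x \<in> I. v x = c}) \<noteq> \<infinity>"
    by (intro nn_integral_noteq_infinite co(1))
  then show ?thesis
  proof (rule AE_mp, intro AE_I2 impI)
    fix c assume c: "indicator (- Z) c * (\<integral>\<^sup>+x. ?h x * ennreal (1 / \<bar>deriv0 v x\<bar>) \<partial>count_space {x \<in> I. v x = c}) \<noteq> \<infinity>"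
      and cZ: "c \<notin> Z"
    have "(\<integral>\<^sup>+x. ?h x * ennreal (1 / \<bar>deriv0 v x\<bar>) \<partial>count_space {x \<in> I. v x = c}) =
        (\<integral>\<^sup>+x. 1 \<partial>count_space {x \<in> I. v x = c})"
    proof (intro nn_integral_cong)
      fix x assume "x \<in> space (count_space {x \<in> I. v x = c})"
      then have "deriv0 v x \<noteq> 0" using crit cZ by auto
      then show "?h x * ennreal (1 / \<bar>deriv0 v x\<bar>) = 1" by (simp add: ennreal_mult[symmetric])
    qed
    then have "emeasure (count_space {x \<in> I. v x = c}) {x \<in> I. v x = c} \<noteq> \<infinity>"
      using c cZ by simp
    then show "finite {x \<in> I. v x = c}"
      by (cases "finite {x \<in> I. v x = c}") (auto simp: emeasure_count_space)
  qed
qed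

text \<open>
  Taking the indicator of \<open>v -` B\<close> for \<open>h\<close> shows that \<open>\<Sum> 1 / |v'(x)|\<close> over the level set is the
  density, off \<open>Z\<close>, of the distribution of \<open>v\<close> on \<open>I\<close>. Functions with equal distributions have equal
  densities almost everywhere.
\<close>

lemma AE_level_weights_eq:
  assumes v: "C-lipschitz_on UNIV v" and w: "D-lipschitz_on UNIV w"
    and I: "I \<in> sets lebesgue" and Z: "Z \<in> sets borel"
    and critv: "\<And>x. x \<in> I \<Longrightarrow> deriv0 v x = 0 \<Longrightarrow> v x \<in> Z"
    and critw: "\<And>x. x \<in> I \<Longrightarrow> deriv0 w x = 0 \<Longrightarrow> w x \<in> Z"
    and eq: "\<And>B. B \<in> sets borel \<Longrightarrow> emeasure lebesgue {x \<in> I. v x \<in> B} = emeasure lebesgue {x \<in> I. w x \<in> B}"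
    and fin: "emeasure lebesgue {x \<in> I. v x \<notin> Z} < \<infinity>"
  shows "AE c in lebesgue. c \<notin> Z \<longrightarrow>
    (\<integral>\<^sup>+x. ennreal (1 / \<bar>deriv0 v x\<bar>) \<partial>count_space {x \<in> I. v x = c}) =
    (\<integral>\<^sup>+x. ennreal (1 / \<bar>deriv0 w x\<bar>) \<partial>count_space {x \<in> I. w x = c})"
proof -
  define g where "g v c = indicator (- Z) c * (\<integral>\<^sup>+x. ennreal (1 / \<bar>deriv0 v x\<bar>) \<partial>count_space {x \<in> I. v x = c})"
    for v c
  have dens: "g v \<in> borel_measurable lebesgue \<and>
      (\<forall>B\<in>sets borel. (\<integral>\<^sup>+c. g v c * indicator B c \<partial>lebesgue) = emeasure lebesgue {x \<in> I. v x \<in> B - Z})"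
    if v: "C-lipschitz_on UNIV v" and crit: "\<And>x. x \<in> I \<Longrightarrow> deriv0 v x = 0 \<Longrightarrow> v x \<in> Z" for C v
  proof (intro conjI ballI)
    show "g v \<in> borel_measurable lebesgue"
      using coarea_off_critical_values(1)[OF v I Z crit, of "\<lambda>_. 1"] by (simp add: g_def[abs_def])
    fix B :: "real set" assume B: "B \<in> sets borel"
    have vB: "(\<lambda>x. indicator (v -` B) x :: ennreal) \<in> borel_measurable lebesgue"
      using vimage_Lipschitz_lebesgue[OF v B] by simp
    have "{x \<in> I. v x \<in> B - Z} = I \<inter> v -` (B - Z)" by auto
    then have "{x \<in> I. v x \<in> B - Z} \<in> sets lebesgue"
      using I vimage_Lipschitz_lebesgue[OF v, of "B - Z"] B Z by auto
    then have "emeasure lebesgue {x \<in> I. v x \<in> B - Z} = (\<integral>\<^sup>+x. indicator {x \<in> I. v x \<in> B - Z} x \<partial>lebesgue)"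
      by (rule nn_integral_indicator[symmetric])
    also have "\<dots> = (\<integral>\<^sup>+x. indicator (v -` B) x * indicator {x \<in> I. v x \<notin> Z} x \<partial>lebesgue)"
      by (intro nn_integral_cong) (auto simp: indicator_def)
    also have "\<dots> = (\<integral>\<^sup>+c. indicator (- Z) c * (\<integral>\<^sup>+x. indicator (v -` B) x * ennreal (1 / \<bar>deriv0 v x\<bar>) \<partial>count_space {x \<in> I. v x = c}) \<partial>lebesgue)"
      by (rule coarea_off_critical_values(2)[OF v I Z crit vB])
    also have "\<dots> = (\<integral>\<^sup>+c. g v c * indicator B c \<partial>lebesgue)"
    proof (intro nn_integral_cong)
      fix c
      have "(\<integral>\<^sup>+x. indicator (v -` B) x * ennreal (1 / \<bar>deriv0 v x\<bar>) \<partial>count_space {x \<in> I. v x = c}) =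
         (\<integral>\<^sup>+x. indicator B c * ennreal (1 / \<bar>deriv0 v x\<bar>) \<partial>count_space {x \<in> I. v x = c})"
        by (intro nn_integral_cong) (auto simp: indicator_def)
      also have "\<dots> = indicator B c * (\<integral>\<^sup>+x. ennreal (1 / \<bar>deriv0 v x\<bar>) \<partial>count_space {x \<in> I. v x = c})"
        by (intro nn_integral_cmult) simp
      finally show "indicator (- Z) c * (\<integral>\<^sup>+x. indicator (v -` B) x * ennreal (1 / \<bar>deriv0 v x\<bar>) \<partial>count_space {x \<in> I. v x = c}) = g v c * indicator B c"
        by (simp add: g_def mult.assoc mult.commute[of "indicator B c"])
    qed
    finally show "(\<integral>\<^sup>+c. g v c * indicator B c \<partial>lebesgue) = emeasure lebesgue {x \<in> I. v x \<in> B - Z}" by simp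
  qed
  note dv = dens[OF v critv] and dw = dens[OF w critw]
  (* The densities are Lebesgue measurable, whereas the distributions are compared on Borel sets. *)
  obtain gv where gv: "gv \<in> borel_measurable lborel" "AE c in lborel. g v c = gv c"
    using completion_ex_borel_measurable[of "g v" lborel] dv by auto
  obtain gw where gw: "gw \<in> borel_measurable lborel" "AE c in lborel. g w c = gw c"
    using completion_ex_borel_measurable[of "g w" lborel] dw by auto
  have int: "(\<integral>\<^sup>+c. g' c * indicator B c \<partial>lborel) = (\<integral>\<^sup>+c. g c * indicator B c \<partial>lebesgue)"
    if "AE c in lborel. g c = g' c" for g g' :: "real \<Rightarrow> ennreal" and B
  proof -
    have "(\<integral>\<^sup>+c. g' c * indicator B c \<partial>lborel) = (\<integral>\<^sup>+c. g c * indicator B c \<partial>lborel)"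
      using that by (intro nn_integral_cong_AE) auto
    then show ?thesis by (simp add: nn_integral_completion)
  qed
  have "density lborel gv = density lborel gw"
  proof (rule measure_eqI)
    fix B assume "B \<in> sets (density lborel gv)"
    then have B: "B \<in> sets borel" by simp
    then show "emeasure (density lborel gv) B = emeasure (density lborel gw) B"
      using gv gw dv dw eq[of "B - Z"] Z by (simp add: emeasure_density int[OF gv(2)] int[OF gw(2)])
  qed simp
  moreover have "integral\<^sup>N lborel gv \<noteq> \<infinity>"
  proof -
    have "integral\<^sup>N lborel gv = emeasure lebesgue {x \<in> I. v x \<in> UNIV - Z}"
      using int[OF gv(2), of UNIV] dv by (auto dest!: bspec[of _ _ UNIV])
    then show ?thesis using fin by simp
  qed
  ultimately have "AE c in lborel. gv c = gw c"
    using gv(1) gw(1) by (subst (asm) finite_density_unique) auto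
  with gv(2) gw(2) have "AE c in lborel. g v c = g w c" by eventually_elim simp
  then have "AE c in lebesgue. g v c = g w c" by (rule AE_completion)
  then show ?thesis by (rule AE_mp) (auto simp: g_def intro!: AE_I2)
qed

text \<open>
  Jensen's inequality with weights \<open>1 / p x\<close>, normalised by their sum. In the application \<open>p x\<close> is a
  slope, \<open>q x\<close> a value of \<open>f\<close>, and \<open>b\<close> the value of \<open>f\<close> at the measure of the superlevel set; monotonicity of
  \<open>g\<close> allows \<open>b\<close> to be smaller than the sum.
\<close>

lemma convex_perspective_sum_ge:
  fixes g :: "real \<Rightarrow> real"
  assumes N: "finite N" "N \<noteq> {}" and p: "\<And>x. x \<in> N \<Longrightarrow> 0 < p x" and q: "\<And>x. x \<in> N \<Longrightarrow> 0 \<le> q x"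
    and g: "convex_on {0..} g" "mono_on {0..} g"
    and b: "0 \<le> b" "b \<le> sum q N"
  shows "(\<Sum>x\<in>N. 1 / p x) * g (b / (\<Sum>x\<in>N. 1 / p x)) \<le> (\<Sum>x\<in>N. g (q x * p x) / p x)"
proof -
  define W where "W = (\<Sum>x\<in>N. 1 / p x)"
  have W: "0 < W" unfolding W_def using N p by (intro sum_pos) auto
  have "b / W \<le> sum q N / W" using b W by (simp add: divide_right_mono)
  also have "sum q N / W = (\<Sum>x\<in>N. (1 / p x / W) *\<^sub>R (q x * p x))"
    unfolding sum_divide_distrib using p W by (intro sum.cong) (auto simp: less_imp_neq[symmetric])
  finally have "g (b / W) \<le> g (\<Sum>x\<in>N. (1 / p x / W) *\<^sub>R (q x * p x))"
    using b W p q by (intro mono_onD[OF g(2)]) (auto intro!: sum_nonneg divide_nonneg_nonneg mult_nonneg_nonneg simp: less_imp_le)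
  also have "\<dots> \<le> (\<Sum>x\<in>N. (1 / p x / W) * g (q x * p x))"
  proof (rule convex_on_sum[OF N g(1)])
    have "(\<Sum>x\<in>N. 1 / p x / W) = W / W" by (simp only: W_def sum_divide_distrib[symmetric])
    then show "(\<Sum>x\<in>N. 1 / p x / W) = 1" using W by simp
  qed (use p q W in \<open>auto simp: less_imp_le\<close>)
  also have "\<dots> = (\<Sum>x\<in>N. g (q x * p x) / p x) / W"
    by (simp add: sum_divide_distrib)
  finally show ?thesis using W by (simp add: W_def[symmetric] pos_le_divide_eq mult.commute)
qed

section \<open>Weighted boundary of superlevel sets\<close>

lemma measure_Int_add_Diff:
  assumes "M \<in> sets lebesgue" "0 \<le> t"
  shows "measure lebesgue ({0<..<t} \<inter> M) + measure lebesgue ({0<..<t} - M) = t"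
proof -
  have I: "{0<..<t} \<in> lmeasurable" by simp
  have "measure lebesgue (({0<..<t} \<inter> M) \<union> ({0<..<t} - M)) =
      measure lebesgue ({0<..<t} \<inter> M) + measure lebesgue ({0<..<t} - M)"
    using fmeasurable_Int_fmeasurable[OF I assms(1)] fmeasurable_Diff[OF I assms(1)]
    by (intro measure_Union) (auto simp: fmeasurable_def)
  moreover have "({0<..<t} \<inter> M) \<union> ({0<..<t} - M) = {0<..<t}" by auto
  ultimately show ?thesis using assms(2) by simp
qed

text \<open>
  Let \<open>S\<close> and \<open>R\<close> be the measures of the parts of \<open>(0, t)\<close> inside and outside \<open>M\<close>, where \<open>M\<close> changes only at
  points of \<open>F\<close>. At the next boundary point \<open>x\<close> one has \<open>S + R = x\<close>, so an estimate for one of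
  \<open>f S\<close>, \<open>f R\<close> gives one for the other at the cost of \<open>f x\<close>: \<open>f (x - R) \<le> f R + f x\<close>. Behind \<open>x\<close> only the
  measure of the part that does not contain the next interval stays constant, and its estimate is the one
  that is carried along. The alternative that a measure is \<open>0\<close> is needed because \<open>f 0\<close> is not
  controlled by the empty sum.
\<close>

lemma weighted_boundary_initial_part:
  fixes f :: "real \<Rightarrow> real" and M F K :: "real set"
  assumes fin: "finite F" and M: "M \<in> sets lebesgue"
    and K: "\<And>x y. y \<in> K \<Longrightarrow> 0 \<le> x \<Longrightarrow> x \<le> y \<Longrightarrow> x \<in> K"
    and sub: "\<And>x y. x \<in> K \<Longrightarrow> y \<in> K \<Longrightarrow> x \<le> y \<Longrightarrow> f (y - x) \<le> f x + f y"
    and t: "0 < t" "t \<in> K" "F \<subseteq> {0<..<t}"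
    and f: "\<And>x. x \<in> F \<Longrightarrow> 0 \<le> f x"
    and loc: "\<And>a b. 0 < a \<Longrightarrow> a \<le> b \<Longrightarrow> b < t \<Longrightarrow> F \<inter> {a..b} = {} \<Longrightarrow> a \<in> M \<longleftrightarrow> b \<in> M"
  shows "\<exists>s. 0 \<le> s \<and> s < t \<and>
     ({s<..<t} \<subseteq> M \<and> (measure lebesgue ({0<..<t} - M) = 0 \<or> f (measure lebesgue ({0<..<t} - M)) \<le> sum f F) \<or>
      {s<..<t} \<inter> M = {} \<and> (measure lebesgue ({0<..<t} \<inter> M) = 0 \<or> f (measure lebesgue ({0<..<t} \<inter> M)) \<le> sum f F))"
  using fin t f loc
proof (induction F arbitrary: t rule: finite_linorder_max_induct)
  case empty
  have all: "a \<in> M \<longleftrightarrow> b \<in> M" if "a \<in> {0<..<t}" "b \<in> {0<..<t}" for a b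
    using empty(5)[of a b] empty(5)[of b a] that by (auto simp: not_le dest: less_imp_le intro: linear[THEN disjE])
  show ?case
  proof (cases "t / 2 \<in> M")
    case True
    then have "{0<..<t} \<subseteq> M" using all[of "t/2"] empty(1) by auto
    moreover from this have "{0<..<t} - M = {}" by auto
    ultimately show ?thesis using empty(1) by (intro exI[of _ 0]) (auto simp only: measure_empty)
  next
    case False
    then have "{0<..<t} \<inter> M = {}" using all[of "t/2"] empty(1) by auto
    then show ?thesis using empty(1) by (intro exI[of _ 0]) (auto simp only: measure_empty)
  qed
next
  case (insert x F)
  have x: "0 < x" "x < t" "x \<in> K" using insert(4,5,6) K[of t x] by auto
  have F: "F \<subseteq> {0<..<x}" using insert(2,6) by auto
  have xF: "x \<notin> F" using insert(2) by auto
  define S where "S = measure lebesgue ({0<..<x} \<inter> M)"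
  define R where "R = measure lebesgue ({0<..<x} - M)"
  have SR: "S + R = x" unfolding S_def R_def using M x by (intro measure_Int_add_Diff) auto
  have SR0: "0 \<le> S" "0 \<le> R" by (auto simp: S_def R_def)
  have sumF: "0 \<le> sum f F" using insert(7) by (intro sum_nonneg) auto
  have sumx: "sum f (insert x F) = f x + sum f F" using insert(1) xF by simp
  have fx: "0 \<le> f x" using insert(7) by auto
  have "(R = 0 \<or> f R \<le> sum f F) \<or> (S = 0 \<or> f S \<le> sum f F)"
    using insert.IH[OF x(1,3) F] insert(7,8) x by (auto simp: S_def R_def)
  moreover have flip: "Q' = 0 \<or> f Q' \<le> f x + sum f F"
    if "Q = 0 \<or> f Q \<le> sum f F" "Q + Q' = x" "0 \<le> Q" "0 \<le> Q'" for Q Q'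
  proof (cases "Q = 0")
    case True
    then show ?thesis using that sumF by auto
  next
    case False
    then have "f (x - Q) \<le> sum f F + f x" using sub[of Q x] K[OF x(3), of Q] x(3) that by auto
    moreover have "x - Q = Q'" using that by simp
    ultimately show ?thesis by simp
  qed
  ultimately have "(R = 0 \<or> f R \<le> f x + sum f F) \<and> (S = 0 \<or> f S \<le> f x + sum f F)"
    using flip[of R S] flip[of S R] SR SR0 fx by (smt (verit))
  then have RS: "R = 0 \<or> f R \<le> f x + sum f F" "S = 0 \<or> f S \<le> f x + sum f F" by auto
  have all: "a \<in> M \<longleftrightarrow> b \<in> M" if "a \<in> {x<..<t}" "b \<in> {x<..<t}" for a b
  proof -
    have "insert x F \<inter> {a..b} = {}" if "x < a" for a b using that F by auto
    then show ?thesis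
      using insert(8)[of a b] insert(8)[of b a] that x linear[of a b] by auto
  qed
  have same: "measure lebesgue A = measure lebesgue B"
    if "B \<in> lmeasurable" "A \<subseteq> insert x B" "B \<subseteq> A" for A B
  proof (rule measure_negligible_symdiff[OF that(1)])
    have "(B - A) \<union> (A - B) \<subseteq> {x}" using that by auto
    then show "negligible ((B - A) \<union> (A - B))" using negligible_sing negligible_subset by blast
  qed
  have lm: "{0<..<x} - M \<in> lmeasurable" "{0<..<x} \<inter> M \<in> lmeasurable"
    using M by (auto intro!: fmeasurable_Diff fmeasurable_Int_fmeasurable)
  define m where "m = (x + t) / 2"
  have m: "m \<in> {x<..<t}" using x by (auto simp: m_def)
  show ?case
  proof (cases "m \<in> M")
    case True
    then have sub: "{x<..<t} \<subseteq> M" using all[OF m] by auto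
    have "measure lebesgue ({0<..<t} - M) = R" unfolding R_def
    proof (rule same)
      show "{0<..<t} - M \<subseteq> insert x ({0<..<x} - M)"
      proof
        fix y assume "y \<in> {0<..<t} - M"
        then show "y \<in> insert x ({0<..<x} - M)" using sub by (cases y x rule: linorder_cases) auto
      qed
    qed (use lm x in auto)
    then show ?thesis using sub RS x sumx by (intro exI[of _ x]) simp
  next
    case False
    then have sub: "{x<..<t} \<inter> M = {}" using all[OF m] by auto
    have "measure lebesgue ({0<..<t} \<inter> M) = S" unfolding S_def
    proof (rule same)
      show "{0<..<t} \<inter> M \<subseteq> insert x ({0<..<x} \<inter> M)"
      proof
        fix y assume "y \<in> {0<..<t} \<inter> M"
        then show "y \<in> insert x ({0<..<x} \<inter> M)" using sub by (cases y x rule: linorder_cases) auto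
      qed
    qed (use lm x in auto)
    then show ?thesis using sub RS x sumx by (intro exI[of _ x]) simp
  qed
qed

lemma open_ival: "open (ival \<alpha>)"
proof -
  have "ival \<alpha> = {0<..} \<inter> ereal -` {..<\<alpha>}" by (auto simp: ival_def)
  also have "open \<dots>" by (intro open_Int open_vimage) (auto intro: continuous_intros)
  finally show ?thesis .
qed

lemma ival_infinite: "ival \<infinity> = {0<..}"
  by (auto simp: ival_def)

lemma ival_ereal: "ival (ereal a) = {0<..<a}"
  by (auto simp: ival_def)

lemma ival_downward: "y \<in> ival \<alpha> \<Longrightarrow> 0 < x \<Longrightarrow> x \<le> y \<Longrightarrow> x \<in> ival \<alpha>"
  using order.strict_trans1[of "ereal x" "ereal y" \<alpha>] by (auto simp: ival_def)

lemma ival_cases [case_names infinite finite]: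
  assumes "0 < \<alpha>"
  obtains "\<alpha> = \<infinity>" "ival \<alpha> = {0<..}" "closure (ival \<alpha>) = {0..}"
    | a where "0 < a" "\<alpha> = ereal a" "ival \<alpha> = {0<..<a}" "closure (ival \<alpha>) = {0..a}"
proof (cases \<alpha>)
  case (real a)
  then show ?thesis using assms that(2)[of a] by (simp add: ival_ereal)
next
  case PInf
  then show ?thesis using that(1) by (simp add: ival_infinite)
qed (use assms in auto)

text \<open>
  If \<open>\<alpha>\<close> is infinite, \<open>M\<close> has finite measure and so does not contain the last, unbounded interval. If
  \<open>\<alpha>\<close> is finite and \<open>M\<close> contains the last interval, the estimate obtained from the walk along the boundary concerns the
  complement of \<open>M\<close>, and the symmetry of \<open>f\<close> transfers it to \<open>M\<close>.
\<close>

lemma weighted_boundary_ge: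
  fixes f v :: "real \<Rightarrow> real"
  assumes \<alpha>: "0 < \<alpha>"
    and pos: "\<And>x. x \<in> ival \<alpha> \<Longrightarrow> 0 < f x"
    and sub: "\<And>x1 x2. x1 \<in> closure (ival \<alpha>) \<Longrightarrow> x2 \<in> closure (ival \<alpha>) \<Longrightarrow> x1 \<le> x2 \<Longrightarrow>
        f (x2 - x1) \<le> f x1 + f x2"
    and sym: "\<And>x. \<alpha> < \<infinity> \<Longrightarrow> x \<in> closure (ival \<alpha>) \<Longrightarrow> f x = f (real_of_ereal \<alpha> - x)"
    and v: "continuous_on UNIV v"
    and fin: "finite {x \<in> ival \<alpha>. v x = c}"
    and M: "{x \<in> ival \<alpha>. v x > c} \<in> lmeasurable"
    and mI: "measure lebesgue {x \<in> ival \<alpha>. v x > c} \<in> ival \<alpha>"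
  shows "f (measure lebesgue {x \<in> ival \<alpha>. v x > c}) \<le> (\<Sum>x\<in>{x \<in> ival \<alpha>. v x = c}. f x)"
proof -
  define M F where "M = {x \<in> ival \<alpha>. v x > c}" and "F = {x \<in> ival \<alpha>. v x = c}"
  have mpos: "measure lebesgue M \<noteq> 0" using mI by (auto simp: M_def ival_def)
  have mI': "measure lebesgue M \<in> ival \<alpha>" using mI by (simp add: M_def)
  have Msets: "M \<in> sets lebesgue" using M by (simp add: M_def)
  have loc: "a \<in> M \<longleftrightarrow> b \<in> M" if ab: "0 < a" "a \<le> b" "b \<in> ival \<alpha>" and disj: "F \<inter> {a..b} = {}" for a b
  proof -
    have I: "y \<in> ival \<alpha>" if "y \<in> {a..b}" for y using that ab ival_downward by auto
    have cont: "continuous_on {a..b} v" using v continuous_on_subset by blast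
    have "v y \<noteq> c" if "y \<in> {a..b}" for y using disj I[OF that] that by (auto simp: F_def)
    note no_c = this
    have "\<not> (v a \<le> c \<and> c \<le> v b)" using IVT'[of v a c b] cont ab no_c by fastforce
    moreover have "\<not> (v b \<le> c \<and> c \<le> v a)" using IVT2'[of v b c a] cont ab no_c by fastforce
    ultimately show ?thesis using I[of a] I[of b] ab by (auto simp: M_def)
  qed
  have K: "x \<in> closure (ival \<alpha>)" if "y \<in> closure (ival \<alpha>)" "0 \<le> x" "x \<le> y" for x y
    using \<alpha> by (cases rule: ival_cases) (use that in auto)
  have fF: "0 \<le> f x" if "x \<in> F" for x using pos that by (auto simp: F_def less_imp_le)
  have aux: "\<exists>s. 0 \<le> s \<and> s < t \<and>
     ({s<..<t} \<subseteq> M \<and> (measure lebesgue ({0<..<t} - M) = 0 \<or> f (measure lebesgue ({0<..<t} - M)) \<le> sum f F) \<or>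
      {s<..<t} \<inter> M = {} \<and> (measure lebesgue ({0<..<t} \<inter> M) = 0 \<or> f (measure lebesgue ({0<..<t} \<inter> M)) \<le> sum f F))"
    if "0 < t" "t \<in> closure (ival \<alpha>)" "F \<subseteq> {0<..<t}"
      "\<And>a b. 0 < a \<Longrightarrow> a \<le> b \<Longrightarrow> b < t \<Longrightarrow> F \<inter> {a..b} = {} \<Longrightarrow> a \<in> M \<longleftrightarrow> b \<in> M" for t
  proof (rule weighted_boundary_initial_part[where K = "closure (ival \<alpha>)"])
    show "finite F" using fin by (simp add: F_def)
  qed (fact | rule K sub fF that; assumption)+
  show ?thesis
    unfolding M_def[symmetric] F_def[symmetric] using \<alpha>
  proof (cases rule: ival_cases)
    case infinite
    (* With the summand 1 the interval (t - 1, t) lies behind all boundary points. *)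
    define t where "t = Max (insert 0 F) + 1"
    have finF: "finite (insert 0 F)" using fin by (simp add: F_def)
    have Ft: "x \<le> t - 1" if "x \<in> F" for x
      using Max_ge[OF finF, of x] that by (simp add: t_def)
    have t: "0 < t" using Max_ge[OF finF, of 0] by (simp add: t_def)
    have F: "F \<subseteq> {0<..<t}" using Ft by (auto simp: F_def ival_def) (force simp: F_def ival_def)
    have tail: "a \<in> M \<longleftrightarrow> b \<in> M" if "t - 1 < a" "t - 1 < b" "0 < a" "0 < b" for a b
    proof -
      have "F \<inter> {a..b} = {}" if "t - 1 < a" for a b using Ft that by force
      then show ?thesis using loc[of a b] loc[of b a] that infinite(2) linear[of a b] by auto
    qed
    have "t \<notin> M"
    proof
      assume "t \<in> M"
      then have "{t..t + measure lebesgue M + 1} \<subseteq> M" using tail[of t] t by auto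
      then have "measure lebesgue {t..t + measure lebesgue M + 1} \<le> measure lebesgue M"
        using M by (intro measure_mono_fmeasurable) (auto simp: M_def)
      then show False by (simp add: add_nonneg_pos)
    qed
    then have disj: "{t..} \<inter> M = {}" using tail[of t] t by auto
    obtain s where s: "0 \<le> s" "s < t"
       "{s<..<t} \<subseteq> M \<and> (measure lebesgue ({0<..<t} - M) = 0 \<or> f (measure lebesgue ({0<..<t} - M)) \<le> sum f F) \<or>
      {s<..<t} \<inter> M = {} \<and> (measure lebesgue ({0<..<t} \<inter> M) = 0 \<or> f (measure lebesgue ({0<..<t} \<inter> M)) \<le> sum f F)"
    proof -
      have "t \<in> closure (ival \<alpha>)" using infinite(3) t by simp
      moreover have "a \<in> M \<longleftrightarrow> b \<in> M" if "0 < a" "a \<le> b" "b < t" "F \<inter> {a..b} = {}" for a b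
        using loc[of a b] that infinite(2) by simp
      ultimately show ?thesis using aux[of t] t F that by blast
    qed
    define p where "p = max ((s + t) / 2) (t - 1/2)"
    have p: "s < p" "p < t" "t - 1 < p" "0 < p" using s(1,2) by (auto simp: p_def less_max_iff_disj)
    then have "p \<notin> M" using tail[of p t] \<open>t \<notin> M\<close> t by auto
    then have "\<not> {s<..<t} \<subseteq> M" using p by auto
    moreover have "{0<..<t} \<inter> M = M"    proof -
      have "M \<subseteq> {0<..}" unfolding M_def infinite(2) by auto
      moreover have "M \<subseteq> {..<t}" using disj by (auto simp: disjoint_iff not_le)
      ultimately show ?thesis by auto
    qed
    ultimately show "f (measure lebesgue M) \<le> sum f F" using s(3) mpos by auto
  next
    case (finite a)
    have F: "F \<subseteq> {0<..<a}" unfolding F_def finite(3) by auto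
    have MI: "{0<..<a} \<inter> M = M" unfolding M_def finite(3) by auto
    obtain s where s: "0 \<le> s" "s < a"
       "{s<..<a} \<subseteq> M \<and> (measure lebesgue ({0<..<a} - M) = 0 \<or> f (measure lebesgue ({0<..<a} - M)) \<le> sum f F) \<or>
      {s<..<a} \<inter> M = {} \<and> (measure lebesgue ({0<..<a} \<inter> M) = 0 \<or> f (measure lebesgue ({0<..<a} \<inter> M)) \<le> sum f F)"
    proof -
      have "a \<in> closure (ival \<alpha>)" using finite(1,4) by simp
      moreover have "x \<in> M \<longleftrightarrow> y \<in> M" if "0 < x" "x \<le> y" "y < a" "F \<inter> {x..y} = {}" for x y
        using loc[of x y] that finite(3) by simp
      ultimately show ?thesis using aux[of a] finite(1) F that by blast
    qed
    have R: "measure lebesgue ({0<..<a} - M) = a - measure lebesgue M"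
      using measure_Int_add_Diff[OF Msets, of a] finite(1) MI by simp
    have m: "0 < measure lebesgue M" "measure lebesgue M < a"
      using mI' unfolding finite(3) by auto
    have "f (a - measure lebesgue M) = f (measure lebesgue M)"
      using sym[of "measure lebesgue M"] m unfolding finite(2) finite(4)[unfolded finite(2)] by simp
    then show "f (measure lebesgue M) \<le> sum f F" using s(3) R MI m by auto
  qed
qed

section \<open>The decreasing rearrangement\<close>

lemma bounded_superlevel:
  assumes "u \<in> class_L I" "0 \<le> c"
  shows "bounded {y \<in> I. c < u y}"
proof -
  have "bounded (closure {x \<in> I. u x \<noteq> 0})"
    using assms by (auto simp: class_L_def compact_imp_bounded)
  moreover have "{y \<in> I. c < u y} \<subseteq> closure {x \<in> I. u x \<noteq> 0}"
    using assms(2) closure_subset[of "{x \<in> I. u x \<noteq> 0}"] by fastforce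
  ultimately show ?thesis by (rule bounded_subset)
qed

lemma lmeasurable_superlevel:
  assumes u: "u \<in> class_L I" and I: "I \<in> sets lebesgue" and c: "0 \<le> c"
  shows "{y \<in> I. c < u y} \<in> lmeasurable"
proof (rule bounded_set_imp_lmeasurable[OF bounded_superlevel[OF u c]])
  have "u \<in> borel_measurable (lebesgue_on I)" using u by (auto simp: class_L_def class_S_def)
  then have "{y \<in> space (lebesgue_on I). c < u y} \<in> sets (lebesgue_on I)" by measurable
  then show "{y \<in> I. c < u y} \<in> sets lebesgue"
    using I by (simp add: sets_restrict_space_iff)
qed

lemma class_L_bounded_above:
  assumes u: "u \<in> class_L I"
  obtains B where "0 \<le> B" "\<And>x. x \<in> I \<Longrightarrow> u x \<le> B"
proof -
  obtain C where C: "C-lipschitz_on I u" using u by (auto simp: class_L_def)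
  have "uniformly_continuous_on {y \<in> I. 0 < u y} u"
    by (rule lipschitz_on_uniformly_continuous[OF lipschitz_on_subset[OF C]]) auto
  then have "bounded (u ` {y \<in> I. 0 < u y})"
    using bounded_superlevel[OF u, of 0] by (intro bounded_uniformly_continuous_image) auto
  then obtain B where B: "\<And>y. y \<in> I \<Longrightarrow> 0 < u y \<Longrightarrow> \<bar>u y\<bar> \<le> B"
    unfolding bounded_iff by auto
  show ?thesis
  proof
    show "u x \<le> max 0 B" if "x \<in> I" for x using B[OF that] by (cases "0 < u x") auto
  qed simp
qed

lemma decr_rearr_nonneg: "0 \<le> decr_rearr I u x"
  if "bdd_above {c. c > 0 \<and> x \<in> set_rearr {y \<in> I. u y > c}}"
proof (cases "{c. c > 0 \<and> x \<in> set_rearr {y \<in> I. u y > c}} = {}")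
  case False
  then obtain c where "c \<in> {c. c > 0 \<and> x \<in> set_rearr {y \<in> I. u y > c}}" by blast
  then have "0 \<le> c" "c \<le> Sup {c. c > 0 \<and> x \<in> set_rearr {y \<in> I. u y > c}}"
    using that by (auto intro: cSup_upper)
  then show ?thesis using False unfolding decr_rearr_def Let_def by simp
qed (simp add: decr_rearr_def Let_def)

lemma decr_rearr_levels_bdd:
  assumes u: "u \<in> class_L I"
  shows "bdd_above {c. c > 0 \<and> x \<in> set_rearr {y \<in> I. u y > c}}"
proof -
  obtain B where B: "0 \<le> B" "\<And>x. x \<in> I \<Longrightarrow> u x \<le> B" using class_L_bounded_above[OF u] by blast
  have "c \<le> B" if "x \<in> set_rearr {y \<in> I. u y > c}" for c
  proof (rule ccontr)
    assume "\<not> c \<le> B"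
    then have "{y \<in> I. u y > c} = {}" using B(2) by force
    then show False using that unfolding set_rearr_def by (simp only: measure_empty) simp
  qed
  then show ?thesis by (auto simp: bdd_above_def)
qed

text \<open>
  The measure of \<open>{u > c}\<close> is right continuous in \<open>c\<close>, so a point in \<open>(0, |{u > c}|)\<close> also lies in
  the corresponding interval for some larger level, which gives the strict inequality.
\<close>

lemma decr_rearr_gt_iff:
  assumes u: "u \<in> class_L I" and I: "I \<in> sets lebesgue" and c: "0 \<le> c"
  shows "c < decr_rearr I u x \<longleftrightarrow> 0 < x \<and> x < measure lebesgue {y \<in> I. c < u y}"
proof -
  define m where "m c = measure lebesgue {y \<in> I. c < u y}" for c
  define A where "A = {c. c > 0 \<and> 0 < x \<and> x < m c}"
  have A: "A = {c. c > 0 \<and> x \<in> set_rearr {y \<in> I. u y > c}}"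
    by (auto simp: A_def set_rearr_def m_def)
  have w: "decr_rearr I u x = (if A = {} then 0 else Sup A)"
    unfolding decr_rearr_def Let_def A ..
  have bdd: "bdd_above A" unfolding A by (rule decr_rearr_levels_bdd[OF u])
  note lm = lmeasurable_superlevel[OF u I]
  show ?thesis
    unfolding m_def[symmetric]
  proof
    assume *: "c < decr_rearr I u x"
    then have "A \<noteq> {}" using w c by auto
    then obtain c' where c': "c' \<in> A" "c < c'"
      using * w less_cSupD[of A c] by auto
    have "m c' \<le> m c"
      unfolding m_def using c c' by (intro measure_mono_fmeasurable lm fmeasurableD) auto
    then show "0 < x \<and> x < m c" using c' by (auto simp: A_def)
  next
    assume *: "0 < x \<and> x < m c"
    define E where "E n = {y \<in> I. c + 1 / Suc n < u y}" for n :: nat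
    have Em: "E n \<in> lmeasurable" for n unfolding E_def using c by (intro lm) auto
    have inc: "incseq E"
    proof (rule incseq_SucI)
      show "E n \<le> E (Suc n)" for n
      proof -
        have "1 / real (Suc (Suc n)) \<le> 1 / real (Suc n)" by (simp add: frac_le)
        then show ?thesis unfolding E_def by (auto simp del: of_nat_Suc)
      qed
    qed
    have UE: "(\<Union>n. E n) = {y \<in> I. c < u y}"
    proof
      show "(\<Union>n. E n) \<subseteq> {y \<in> I. c < u y}"
      proof
        fix y assume "y \<in> (\<Union>n. E n)"
        then obtain n where "y \<in> I" "c + 1 / real (Suc n) < u y" unfolding E_def by blast
        moreover have "0 < 1 / real (Suc n)" by simp
        ultimately have "c < u y" by linarith
        then show "y \<in> {y \<in> I. c < u y}" using \<open>y \<in> I\<close> by simp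
      qed
      show "{y \<in> I. c < u y} \<subseteq> (\<Union>n. E n)"
      proof
        fix y assume y: "y \<in> {y \<in> I. c < u y}"
        then obtain n where "1 / Suc n < u y - c" using nat_approx_posE[of "u y - c"] by auto
        then have "y \<in> E n" using y by (auto simp: E_def simp del: of_nat_Suc)
        then show "y \<in> (\<Union>n. E n)" by blast
      qed
    qed
    have "(\<lambda>n. measure lebesgue (E n)) \<longlonglongrightarrow> measure lebesgue (\<Union>n. E n)"
      using Em inc lm[OF c] by (intro Lim_measure_incseq) (auto simp: UE fmeasurable_def)
    then have "(\<lambda>n. measure lebesgue (E n)) \<longlonglongrightarrow> m c" by (simp only: UE m_def)
    then have "\<forall>\<^sub>F n in sequentially. x < measure lebesgue (E n)"
      using * by (intro order_tendstoD(1)) auto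
    then obtain n where "x < measure lebesgue (E n)"
      using eventually_happens trivial_limit_sequentially by blast
    then have "c + 1 / Suc n \<in> A" using * c by (auto simp: A_def E_def m_def add_nonneg_pos)
    then have "A \<noteq> {}" "c + 1 / Suc n \<le> Sup A" using bdd by (auto intro: cSup_upper)
    moreover have "c < c + 1 / Suc n" by simp
    ultimately have "c < Sup A" by linarith
    then show "c < decr_rearr I u x" unfolding w using \<open>A \<noteq> {}\<close> by simp
  qed
qed

lemma decr_rearr_antimono:
  assumes u: "u \<in> class_L I" and I: "I \<in> sets lebesgue" and xy: "0 < x" "x \<le> y"
  shows "decr_rearr I u y \<le> decr_rearr I u x"
proof (rule ccontr)
  assume "\<not> ?thesis"
  moreover have "0 \<le> decr_rearr I u x" by (intro decr_rearr_nonneg decr_rearr_levels_bdd u)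
  ultimately show False
    using decr_rearr_gt_iff[OF u I, of "decr_rearr I u x"] xy by (meson leI less_irrefl order_le_less_trans)
qed

lemma superlevel_rearr:
  assumes u: "u \<in> class_L (ival \<alpha>)" and \<alpha>: "0 < \<alpha>" and c: "0 \<le> c"
  shows "{x \<in> ival \<alpha>. c < decr_rearr (ival \<alpha>) u x} = {0<..<measure lebesgue {y \<in> ival \<alpha>. c < u y}}"
proof -
  have I: "ival \<alpha> \<in> sets lebesgue" using open_ival by auto
  have "x \<in> ival \<alpha>" if "0 < x" "x < measure lebesgue {y \<in> ival \<alpha>. c < u y}" for x
    using \<alpha>
  proof (cases rule: ival_cases)
    case (finite a)
    have "{y \<in> ival \<alpha>. c < u y} \<subseteq> {0<..<a}" unfolding finite(3) by auto
    then have "measure lebesgue {y \<in> ival \<alpha>. c < u y} \<le> measure lebesgue {0<..<a}"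
      using lmeasurable_superlevel[OF u I c] by (intro measure_mono_fmeasurable fmeasurableD) auto
    also have "\<dots> = a" using finite(1) by simp
    finally show ?thesis using that unfolding finite(3) by simp
  next
    case infinite
    show ?thesis using that(1) unfolding infinite(2) by simp
  qed
  then have "x \<in> ival \<alpha> \<and> c < decr_rearr (ival \<alpha>) u x \<longleftrightarrow>
      x \<in> {0<..<measure lebesgue {y \<in> ival \<alpha>. c < u y}}" for x
    unfolding greaterThanLessThan_iff decr_rearr_gt_iff[OF u I c] by blast
  then show ?thesis by blast
qed

text \<open>
  Between two levels \<open>c < d\<close> that \<open>w\<close> crosses, \<open>u\<close> takes every intermediate value by the intermediate value
  theorem, and it needs a set of measure at least \<open>(d - c) / C\<close> for this. That measure is the
  distance between the end points of the two superlevel sets of \<open>w\<close>.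
\<close>

lemma decr_rearr_Lipschitz:
  assumes \<alpha>: "0 < \<alpha>" and u: "u \<in> class_L (ival \<alpha>)" and C: "C-lipschitz_on (ival \<alpha>) u"
  shows "C-lipschitz_on (ival \<alpha>) (decr_rearr (ival \<alpha>) u)"
proof -
  let ?I = "ival \<alpha>" and ?w = "decr_rearr (ival \<alpha>) u"
  define m where "m c = measure lebesgue {y \<in> ?I. c < u y}" for c
  have I: "?I \<in> sets lebesgue" using open_ival by auto
  have C0: "0 \<le> C" using C lipschitz_on_nonneg by blast
  have "?I \<noteq> {}" using \<alpha> by (cases rule: ival_cases) auto
  then obtain v where v: "C-lipschitz_on UNIV v" "\<And>x. x \<in> ?I \<Longrightarrow> v x = u x"
    using Lipschitz_extension[OF C] by blast
  have contv: "continuous_on A v" for A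
    using lipschitz_on_continuous_on[OF v(1)] continuous_on_subset by blast
  note lm = lmeasurable_superlevel[OF u I]
  note gt = decr_rearr_gt_iff[OF u I, folded m_def]
  have w0: "0 \<le> ?w x" for x by (intro decr_rearr_nonneg decr_rearr_levels_bdd u)
  have gap: "d - c \<le> C * (m c - m d)"
    if cd: "0 \<le> c" "c < d" "0 < m d" and z: "z \<in> ?I" "m c \<le> z" for c d z
  proof -
    have "{y \<in> ?I. d < u y} \<noteq> {}"
    proof
      assume "{y \<in> ?I. d < u y} = {}"
      then have "m d = 0" unfolding m_def by (metis measure_empty)
      then show False using cd by simp
    qed
    then obtain p where p: "p \<in> ?I" "d < v p" using v(2) by auto
    have "\<exists>q\<in>?I. v q \<le> c"
    proof (rule ccontr)
      assume "\<not> ?thesis"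
      then have eq: "{y \<in> ?I. c < u y} = ?I" using v(2) by force
      then have lmI: "?I \<in> lmeasurable" using lm[OF cd(1)] by simp
      (* Otherwise {u > c} would be the whole interval, whose measure exceeds z. *)
      obtain z' where z': "z' \<in> ?I" "z < z'"
      proof -
        obtain e where e: "0 < e" "ball z e \<subseteq> ?I"
          using open_ival[of \<alpha>] z(1) unfolding open_contains_ball by blast
        then have "z + e / 2 \<in> ?I" by (auto simp: dist_real_def)
        then show ?thesis using that[of "z + e / 2"] e by simp
      qed
      have "{0<..<z'} \<subseteq> ?I" using z' ival_downward by auto
      then have "measure lebesgue {0<..<z'} \<le> measure lebesgue ?I"
        using lmI by (intro measure_mono_fmeasurable) auto
      moreover have "0 < z'" using z' by (auto simp: ival_def)
      ultimately have "z' \<le> m c" using eq by (simp add: m_def)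
      then show False using z z' by simp
    qed
    then obtain q where q: "q \<in> ?I" "v q \<le> c" by blast
    define E where "E = {y \<in> ?I. c < u y} - {y \<in> ?I. d < u y}"
    have E: "E \<in> lmeasurable" unfolding E_def using cd by (intro fmeasurable_Diff lm fmeasurableD) auto
    have Em: "measure lebesgue E = m c - m d"
      unfolding E_def m_def using cd lm
      by (intro measurable_measure_Diff) auto
    have "{c<..<d} \<subseteq> v ` E"
    proof
      fix y assume y: "y \<in> {c<..<d}"
      have "\<exists>x\<in>closed_segment q p. v x = y"
        using contv y p q by (intro IVT'_closed_segment_real) (auto simp: closed_segment_eq_real_ivl)
      then obtain x where x: "x \<in> closed_segment q p" "v x = y" by blast
      have "min p q \<le> x" "x \<le> max p q" using x by (auto simp: closed_segment_eq_real_ivl split: if_splits)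
      moreover have "0 < min p q" "max p q \<in> ?I" using p q by (auto simp: ival_def max_def)
      ultimately have "x \<in> ?I" using ival_downward by (meson less_le_trans)
      then show "y \<in> v ` E" using x y v(2) by (auto simp: E_def)
    qed
    then have "emeasure lebesgue {c<..<d} \<le> emeasure lebesgue (v ` E)"
      using sets_lebesgue_Lipschitz_image[OF v(1)] E by (intro emeasure_mono) auto
    also have "\<dots> \<le> ennreal C * emeasure lebesgue E"
      using E by (intro emeasure_Lipschitz_image_le[OF v(1)]) auto
    also have "\<dots> = ennreal (C * measure lebesgue E)"
      using E C0 by (simp add: emeasure_eq_measure2 ennreal_mult)
    finally have "ennreal (d - c) \<le> ennreal (C * measure lebesgue E)" using cd by simp
    then show ?thesis using C0 unfolding Em[symmetric] by (simp add: ennreal_le_iff)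
  qed
  have half: "?w x - ?w y \<le> C * (y - x)" if xy: "x \<in> ?I" "y \<in> ?I" "x < y" for x y
  proof (rule ccontr)
    assume "\<not> ?thesis"
    then obtain d where d: "?w y + C * (y - x) < d" "d < ?w x"
      using dense[of "?w y + C * (y - x)" "?w x"] by auto
    have "0 \<le> C * (y - x)" using C0 xy by simp
    then have dy: "?w y < d" using d by linarith
    then have "0 \<le> d" using w0[of y] by linarith
    then have "x < m d" "0 < x" using gt[of d x] d by auto
    moreover have "m (?w y) \<le> y"
      using gt[of "?w y" y] w0[of y] xy by (auto simp: ival_def)
    ultimately have "d - ?w y \<le> C * (m (?w y) - m d)" "m (?w y) - m d \<le> y - x"
      using gap[of "?w y" d y] w0[of y] dy xy by auto
    moreover from this(2) C0 have "C * (m (?w y) - m d) \<le> C * (y - x)" by (rule mult_left_mono)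
    ultimately show False using d by linarith
  qed
  show ?thesis
  proof (rule lipschitz_onI)
    fix x y assume xy: "x \<in> ?I" "y \<in> ?I"
    have pos: "0 < x" "0 < y" using xy by (auto simp: ival_def)
    show "dist (?w x) (?w y) \<le> C * dist x y"
      using half[of x y] half[of y x] xy decr_rearr_antimono[OF u I pos(1), of y]
        decr_rearr_antimono[OF u I pos(2), of x]
      by (cases x y rule: linorder_cases) (auto simp: dist_real_def)
  qed (rule C0)
qed

lemma decr_rearr_class_L:
  assumes \<alpha>: "0 < \<alpha>" and u: "u \<in> class_L (ival \<alpha>)"
  shows "decr_rearr (ival \<alpha>) u \<in> class_L (ival \<alpha>)"
proof -
  let ?I = "ival \<alpha>" and ?w = "decr_rearr (ival \<alpha>) u"
  have I: "?I \<in> sets lebesgue" using open_ival by auto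
  obtain C where "C-lipschitz_on ?I u" using u by (auto simp: class_L_def)
  then have C: "C-lipschitz_on ?I ?w" by (rule decr_rearr_Lipschitz[OF \<alpha> u])
  have w0: "0 \<le> ?w x" for x by (intro decr_rearr_nonneg decr_rearr_levels_bdd u)
  have "?w \<in> borel_measurable (lebesgue_on ?I)"
    using lipschitz_on_continuous_on[OF C] I by (rule continuous_imp_measurable_on_sets_lebesgue)
  moreover have "emeasure lebesgue {x \<in> ?I. c < ?w x} < \<infinity>" if "0 < c" for c
    using superlevel_rearr[OF u \<alpha>, of c] that by simp
  moreover have "compact (closure {x \<in> ?I. ?w x \<noteq> 0})"
  proof -
    have "{x \<in> ?I. ?w x \<noteq> 0} = {x \<in> ?I. 0 < ?w x}" using w0 by (auto simp: less_le)
    also have "bounded \<dots>" unfolding superlevel_rearr[OF u \<alpha> order_refl] by simp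
    finally show ?thesis by simp
  qed
  ultimately show ?thesis using C w0 by (auto simp: class_L_def class_S_def)
qed

text \<open>
  The superlevel sets of positive level have finite measure and generate the Borel sets of
  \<open>(0, \<infinity>)\<close>. The value \<open>0\<close> is treated separately, since the set where it is taken may have infinite measure.
\<close>

lemma distr_eq_of_superlevels:
  fixes u w :: "real \<Rightarrow> real"
  assumes I: "I \<in> sets lebesgue"
    and um: "u \<in> borel_measurable (lebesgue_on I)" and wm: "w \<in> borel_measurable (lebesgue_on I)"
    and nonneg: "\<And>x. x \<in> I \<Longrightarrow> 0 \<le> u x" "\<And>x. x \<in> I \<Longrightarrow> 0 \<le> w x"
    and fin: "\<And>c. 0 \<le> c \<Longrightarrow> emeasure lebesgue {x \<in> I. c < u x} < \<infinity>"
    and eq: "\<And>c. 0 \<le> c \<Longrightarrow> emeasure lebesgue {x \<in> I. c < u x} = emeasure lebesgue {x \<in> I. c < w x}"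
  shows "distr (lebesgue_on I) borel u = distr (lebesgue_on I) borel w"
proof -
  have vim: "{x \<in> I. P (g x)} \<in> sets lebesgue \<and>
     emeasure (distr (lebesgue_on I) borel g) {c. P c} = emeasure lebesgue {x \<in> I. P (g x)}"
    if g: "g \<in> borel_measurable (lebesgue_on I)" and P: "{c. P c} \<in> sets borel" for g :: "real \<Rightarrow> real" and P
  proof -
    have "g -` {c. P c} \<inter> space (lebesgue_on I) = {x \<in> I. P (g x)}" by auto
    moreover have "g -` {c. P c} \<inter> space (lebesgue_on I) \<in> sets (lebesgue_on I)"
      using g P by (rule measurable_sets)
    ultimately show ?thesis
      using g P I by (simp add: emeasure_distr emeasure_restrict_space sets_restrict_space_iff)
  qed
  define pos where "pos g = density (distr (lebesgue_on I) borel g) (indicator {0<..})" for g :: "real \<Rightarrow> real"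
  have pos: "emeasure (pos g) {c. P c} = emeasure lebesgue {x \<in> I. 0 < g x \<and> P (g x)}"
    if g: "g \<in> borel_measurable (lebesgue_on I)" and P: "{c. P c} \<in> sets borel" for g P
  proof -
    have "emeasure (pos g) {c. P c} = (\<integral>\<^sup>+c. indicator {c. 0 < c \<and> P c} c \<partial>distr (lebesgue_on I) borel g)"
      unfolding pos_def using P by (subst emeasure_density) (auto intro!: nn_integral_cong split: split_indicator)
    also have "\<dots> = emeasure (distr (lebesgue_on I) borel g) {c. 0 < c \<and> P c}"
    proof (rule nn_integral_indicator)
      have "{c. 0 < c \<and> P c} = {0<..} \<inter> {c. P c}" by auto
      then show "{c. 0 < c \<and> P c} \<in> sets (distr (lebesgue_on I) borel g)" using P by auto
    qed
    also have "\<dots> = emeasure lebesgue {x \<in> I. 0 < g x \<and> P (g x)}"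
    proof -
      have "{c. 0 < c \<and> P c} = {0<..} \<inter> {c. P c}" by auto
      then have "{c. 0 < c \<and> P c} \<in> sets borel" using P by auto
      from vim[OF g this] show ?thesis by simp
    qed
    finally show ?thesis .
  qed
  have posgt: "emeasure (pos g) {c<..} = emeasure lebesgue {x \<in> I. max 0 c < g x}"
    if "g \<in> borel_measurable (lebesgue_on I)" for g c
    using pos[OF that, of "\<lambda>y. c < y"] by (simp add: greaterThan_def)
  have "pos u = pos w"
  proof (rule measure_eqI_lessThan)
    show "emeasure (pos u) {c<..} < \<infinity>" for c using fin[of "max 0 c"] posgt[OF um] by simp
    show "emeasure (pos u) {c<..} = emeasure (pos w) {c<..}" for c
      using eq[of "max 0 c"] posgt[OF um] posgt[OF wm] by simp
  qed (simp_all add: pos_def)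
  have zero: "emeasure lebesgue {x \<in> I. u x = 0} = emeasure lebesgue {x \<in> I. w x = 0}"
  proof -
    have "emeasure lebesgue {x \<in> I. g x = 0} = emeasure lebesgue I - emeasure lebesgue {x \<in> I. 0 < g x}"
      if "g \<in> borel_measurable (lebesgue_on I)" "\<And>x. x \<in> I \<Longrightarrow> 0 \<le> g x"
        "emeasure lebesgue {x \<in> I. 0 < g x} < \<infinity>" for g :: "real \<Rightarrow> real"
    proof -
      have "{x \<in> I. g x = 0} = I - {x \<in> I. 0 < g x}" using that(2) by (force simp: less_le)
      then show ?thesis
        using vim[OF that(1), of "\<lambda>c. 0 < c"] that(3) I by (simp add: emeasure_Diff greaterThan_def[symmetric])
    qed
    then show ?thesis using um wm nonneg fin[of 0] eq[of 0] by simp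
  qed
  show ?thesis
  proof (rule measure_eqI)
    fix B :: "real set" assume "B \<in> sets (distr (lebesgue_on I) borel u)"
    then have B: "B \<in> sets borel" by simp
    have "emeasure (distr (lebesgue_on I) borel g) B =
        emeasure (pos g) B + (if 0 \<in> B then emeasure lebesgue {x \<in> I. g x = 0} else 0)"
      if g: "g \<in> borel_measurable (lebesgue_on I)" and g0: "\<And>x. x \<in> I \<Longrightarrow> 0 \<le> g x" for g
    proof -
      have "emeasure (distr (lebesgue_on I) borel g) B = emeasure lebesgue {x \<in> I. g x \<in> B}"
        using vim[OF g, of "\<lambda>c. c \<in> B"] B by simp
      also have "{x \<in> I. g x \<in> B} = {x \<in> I. 0 < g x \<and> g x \<in> B} \<union> (if 0 \<in> B then {x \<in> I. g x = 0} else {})"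
        using g0 by (force simp: less_le)
      also have "emeasure lebesgue \<dots> = emeasure lebesgue {x \<in> I. 0 < g x \<and> g x \<in> B} +
          emeasure lebesgue (if 0 \<in> B then {x \<in> I. g x = 0} else {})"
      proof (rule plus_emeasure[symmetric])
        have "{c. 0 < c \<and> c \<in> B} = {0<..} \<inter> B" by auto
        then have "{c. 0 < c \<and> c \<in> B} \<in> sets borel" using B by auto
        from vim[OF g this] show "{x \<in> I. 0 < g x \<and> g x \<in> B} \<in> sets lebesgue" by simp
        show "(if 0 \<in> B then {x \<in> I. g x = 0} else {}) \<in> sets lebesgue"
          using vim[OF g, of "\<lambda>c. c = 0"] by simp
      qed auto
      finally show ?thesis using pos[OF g, of "\<lambda>c. c \<in> B"] B by simp
    qed
    then show "emeasure (distr (lebesgue_on I) borel u) B = emeasure (distr (lebesgue_on I) borel w) B"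
      using um wm nonneg \<open>pos u = pos w\<close> zero by simp
  qed simp
qed

section \<open>The rearrangement inequality\<close>

text \<open>
  The comparison on a single level. A level set of \<open>w\<close> that is finite contains at most the end
  point \<open>m\<close> of \<open>{w > c} = (0, m)\<close>, because \<open>w\<close> is monotone. If it does contain \<open>m\<close>, equality of the weights
  gives \<open>1 / |w'(m)| = \<Sum> 1 / |v'(x)|\<close>, and the claim is Jensen's inequality combined with the
  estimate of \<open>f m\<close> by the boundary of \<open>{v > c}\<close>.
\<close>

lemma level_energy_le:
  fixes f v w :: "real \<Rightarrow> real" and g :: "real \<Rightarrow> real"
  assumes \<alpha>: "0 < \<alpha>"
    and pos: "\<And>x. x \<in> ival \<alpha> \<Longrightarrow> 0 < f x"
    and sub: "\<And>x1 x2. x1 \<in> closure (ival \<alpha>) \<Longrightarrow> x2 \<in> closure (ival \<alpha>) \<Longrightarrow> x1 \<le> x2 \<Longrightarrow>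
        f (x2 - x1) \<le> f x1 + f x2"
    and sym: "\<And>x. \<alpha> < \<infinity> \<Longrightarrow> x \<in> closure (ival \<alpha>) \<Longrightarrow> f x = f (real_of_ereal \<alpha> - x)"
    and g: "convex_on {0..} g" "mono_on {0..} g" "\<And>z. 0 \<le> z \<Longrightarrow> 0 \<le> g z"
    and v: "continuous_on UNIV v"
    and M: "{x \<in> ival \<alpha>. c < v x} \<in> lmeasurable"
    and wgt: "{x \<in> ival \<alpha>. c < w x} = {0<..<measure lebesgue {x \<in> ival \<alpha>. c < v x}}"
    and anti: "\<And>x y. 0 < x \<Longrightarrow> x \<le> y \<Longrightarrow> y \<in> ival \<alpha> \<Longrightarrow> w y \<le> w x"
    and finv: "finite {x \<in> ival \<alpha>. v x = c}" and finw: "finite {x \<in> ival \<alpha>. w x = c}"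
    and regv: "\<And>x. x \<in> ival \<alpha> \<Longrightarrow> v x = c \<Longrightarrow> deriv0 v x \<noteq> 0"
    and regw: "\<And>x. x \<in> ival \<alpha> \<Longrightarrow> w x = c \<Longrightarrow> deriv0 w x \<noteq> 0"
    and weights: "(\<integral>\<^sup>+x. ennreal (1 / \<bar>deriv0 v x\<bar>) \<partial>count_space {x \<in> ival \<alpha>. v x = c}) =
      (\<integral>\<^sup>+x. ennreal (1 / \<bar>deriv0 w x\<bar>) \<partial>count_space {x \<in> ival \<alpha>. w x = c})"
  shows "(\<integral>\<^sup>+x. ennreal (g (f x * \<bar>deriv0 w x\<bar>)) * ennreal (1 / \<bar>deriv0 w x\<bar>) \<partial>count_space {x \<in> ival \<alpha>. w x = c})
    \<le> (\<integral>\<^sup>+x. ennreal (g (f x * \<bar>deriv0 v x\<bar>)) * ennreal (1 / \<bar>deriv0 v x\<bar>) \<partial>count_space {x \<in> ival \<alpha>. v x = c})"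
proof -
  define Nv Nw where "Nv = {x \<in> ival \<alpha>. v x = c}" and "Nw = {x \<in> ival \<alpha>. w x = c}"
  define m where "m = measure lebesgue {x \<in> ival \<alpha>. c < v x}"
  have only_m: "x = m" if "x \<in> Nw" for x
  proof -
    have x: "x \<in> ival \<alpha>" "w x = c" "0 < x" using that by (auto simp: Nw_def ival_def)
    then have "x \<notin> {x \<in> ival \<alpha>. c < w x}" by simp
    then have "x \<notin> {0<..<m}" unfolding wgt m_def .
    then have "m \<le> x" using x by simp
    moreover have "\<not> m < x"
    proof
      assume "m < x"
      have "0 \<le> m" by (simp add: m_def)
      have "{m<..<x} \<subseteq> Nw"
      proof
        fix y assume y: "y \<in> {m<..<x}"
        then have yI: "y \<in> ival \<alpha>" using ival_downward[OF x(1), of y] \<open>0 \<le> m\<close> by auto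
        have "y \<notin> {x \<in> ival \<alpha>. c < w x}" unfolding wgt using y by (simp add: m_def)
        then have "w y \<le> c" using yI by auto
        moreover have "w x \<le> w y" using y x \<open>0 \<le> m\<close> by (intro anti) auto
        ultimately show "y \<in> Nw" using yI x by (simp add: Nw_def)
      qed
      then have "finite {m<..<x}" using finw finite_subset by (auto simp: Nw_def)
      then show False using infinite_Ioo[OF \<open>m < x\<close>] by simp
    qed
    ultimately show ?thesis by simp
  qed
  show ?thesis
    unfolding Nv_def[symmetric] Nw_def[symmetric]
  proof (cases "Nw = {}")
    case True
    then show "(\<integral>\<^sup>+x. ennreal (g (f x * \<bar>deriv0 w x\<bar>)) * ennreal (1 / \<bar>deriv0 w x\<bar>) \<partial>count_space Nw)
      \<le> (\<integral>\<^sup>+x. ennreal (g (f x * \<bar>deriv0 v x\<bar>)) * ennreal (1 / \<bar>deriv0 v x\<bar>) \<partial>count_space Nv)"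
      by (simp add: nn_integral_empty)
  next
    case False
    then have Nw: "Nw = {m}" using only_m by auto
    then have mI: "m \<in> ival \<alpha>" "w m = c" by (auto simp: Nw_def)
    have dm: "deriv0 w m \<noteq> 0" using regw mI by auto
    have dv: "0 < \<bar>deriv0 v x\<bar>" if "x \<in> Nv" for x using regv[of x] that by (auto simp: Nv_def)
    have fv: "0 \<le> f x" if "x \<in> Nv" for x using pos[of x] that by (auto simp: Nv_def)
    have fNv: "finite Nv" using finv by (simp add: Nv_def)
    have "(\<integral>\<^sup>+x. ennreal (1 / \<bar>deriv0 v x\<bar>) \<partial>count_space Nv) = ennreal (\<Sum>x\<in>Nv. 1 / \<bar>deriv0 v x\<bar>)"
      using fNv by (simp add: nn_integral_count_space_finite sum_ennreal)
    moreover have "(\<integral>\<^sup>+x. ennreal (1 / \<bar>deriv0 w x\<bar>) \<partial>count_space Nw) = ennreal (1 / \<bar>deriv0 w m\<bar>)"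
      unfolding Nw by (simp add: nn_integral_count_space_finite)
    ultimately have "ennreal (\<Sum>x\<in>Nv. 1 / \<bar>deriv0 v x\<bar>) = ennreal (1 / \<bar>deriv0 w m\<bar>)"
      using weights unfolding Nv_def[symmetric] Nw_def[symmetric] by simp
    then have W: "(\<Sum>x\<in>Nv. 1 / \<bar>deriv0 v x\<bar>) = 1 / \<bar>deriv0 w m\<bar>"
      by (subst (asm) ennreal_inj) (auto intro!: sum_nonneg)
    then have "Nv \<noteq> {}" using dm by auto
    have bd: "f m \<le> sum f Nv"
      using weighted_boundary_ge[OF \<alpha> pos sub sym v finv M] mI(1) by (simp add: m_def Nv_def)
    have "1 / \<bar>deriv0 w m\<bar> * g (f m * \<bar>deriv0 w m\<bar>) \<le> (\<Sum>x\<in>Nv. g (f x * \<bar>deriv0 v x\<bar>) / \<bar>deriv0 v x\<bar>)"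
      using convex_perspective_sum_ge[where p = "\<lambda>x. \<bar>deriv0 v x\<bar>" and q = f and g = g and b = "f m",
          OF fNv \<open>Nv \<noteq> {}\<close> dv fv g(1,2) _ bd] pos[OF mI(1)]
      unfolding W by simp
    then have "ennreal (g (f m * \<bar>deriv0 w m\<bar>) * (1 / \<bar>deriv0 w m\<bar>)) \<le>
        ennreal (\<Sum>x\<in>Nv. g (f x * \<bar>deriv0 v x\<bar>) / \<bar>deriv0 v x\<bar>)"
      by (intro ennreal_leI) (simp add: mult.commute)
    moreover have gm: "0 \<le> g (f m * \<bar>deriv0 w m\<bar>)" using pos[OF mI(1)] by (intro g) simp
    moreover have "(\<Sum>x\<in>Nv. ennreal (g (f x * \<bar>deriv0 v x\<bar>)) * ennreal (1 / \<bar>deriv0 v x\<bar>)) =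
        ennreal (\<Sum>x\<in>Nv. g (f x * \<bar>deriv0 v x\<bar>) / \<bar>deriv0 v x\<bar>)"
    proof -
      have gx: "0 \<le> g (f x * \<bar>deriv0 v x\<bar>)" if "x \<in> Nv" for x using fv[OF that] by (intro g) simp
      have "(\<Sum>x\<in>Nv. ennreal (g (f x * \<bar>deriv0 v x\<bar>)) * ennreal (1 / \<bar>deriv0 v x\<bar>)) =
        (\<Sum>x\<in>Nv. ennreal (g (f x * \<bar>deriv0 v x\<bar>) / \<bar>deriv0 v x\<bar>))"
        using gx by (intro sum.cong) (auto simp: ennreal_mult[symmetric])
      also have "\<dots> = ennreal (\<Sum>x\<in>Nv. g (f x * \<bar>deriv0 v x\<bar>) / \<bar>deriv0 v x\<bar>)"
        using gx by (intro sum_ennreal) auto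
      finally show ?thesis .
    qed
    ultimately show "(\<integral>\<^sup>+x. ennreal (g (f x * \<bar>deriv0 w x\<bar>)) * ennreal (1 / \<bar>deriv0 w x\<bar>) \<partial>count_space Nw)
      \<le> (\<integral>\<^sup>+x. ennreal (g (f x * \<bar>deriv0 v x\<bar>)) * ennreal (1 / \<bar>deriv0 v x\<bar>) \<partial>count_space Nv)"
      using fNv unfolding Nw by (simp add: nn_integral_count_space_finite ennreal_mult[symmetric])
  qed
qed

theorem theorem2p9:
  fixes \<alpha> :: ereal and I :: "real set" and f u :: "real \<Rightarrow> real"
    and G :: "real \<Rightarrow> real \<Rightarrow> real"
  assumes "0 < \<alpha>" and "I = ival \<alpha>"
    and "continuous_on (closure I) f"
    and "\<And>x. x \<in> I \<Longrightarrow> 0 < f x"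
    and "\<And>x1 x2. x1 \<in> closure I \<Longrightarrow> x2 \<in> closure I \<Longrightarrow> x1 \<le> x2 \<Longrightarrow> f (x2 - x1) \<le> f x1 + f x2"
    and "\<And>x. \<alpha> < \<infinity> \<Longrightarrow> x \<in> closure I \<Longrightarrow> f x = f (real_of_ereal \<alpha> - x)"
    and "\<And>z v. 0 \<le> z \<Longrightarrow> 0 \<le> v \<Longrightarrow> 0 \<le> G z v"
    and "continuous_on ({0..} \<times> {0..}) (\<lambda>(z, v). G z v)"
    and "\<And>v. 0 \<le> v \<Longrightarrow> convex_on {0..} (\<lambda>z. G z v)"
    and "\<And>v. 0 \<le> v \<Longrightarrow> mono_on {0..} (\<lambda>z. G z v)"
    and "u \<in> class_L I"
  shows "decr_rearr I u \<in> class_L I \<and>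
    (\<integral>\<^sup>+ x\<in>I. ennreal (G (f x * \<bar>deriv u x\<bar>) (u x)) \<partial>lebesgue) \<ge>
    (\<integral>\<^sup>+ x\<in>I. ennreal (G (f x * \<bar>deriv (decr_rearr I u) x\<bar>) (decr_rearr I u x)) \<partial>lebesgue)"
proof
  note \<alpha> = assms(1) and I_def = assms(2) and f_cont = assms(3) and f_pos = assms(4)
    and f_sub = assms(5) and f_sym = assms(6) and G_nonneg = assms(7) and G_cont = assms(8)
    and G_convex = assms(9) and G_mono = assms(10) and u_L = assms(11)
  define w where "w = decr_rearr I u"
  show w_L: "decr_rearr I u \<in> class_L I"
    using decr_rearr_class_L[OF \<alpha>] u_L by (simp add: I_def)
  have openI: "open I" and I_meas: "I \<in> sets lebesgue" using open_ival[of \<alpha>] by (auto simp: I_def)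
  have neI: "I \<noteq> {}" using \<alpha> unfolding I_def by (cases rule: ival_cases) auto
  have u_meas: "u \<in> borel_measurable (lebesgue_on I)" and u_nonneg: "\<And>x. x \<in> I \<Longrightarrow> 0 \<le> u x"
    using u_L by (auto simp: class_L_def class_S_def)
  have w_meas: "w \<in> borel_measurable (lebesgue_on I)" and w_nonneg: "\<And>x. x \<in> I \<Longrightarrow> 0 \<le> w x"
    using w_L by (auto simp: class_L_def class_S_def w_def)
  (* Lipschitz extensions of u and w to the whole line serve in place of u and w; on the open set I
     they have the same derivatives. *)
  obtain C u' where u': "C-lipschitz_on UNIV u'" "\<And>x. x \<in> I \<Longrightarrow> u' x = u x"
    using u_L Lipschitz_extension[OF _ neI, of _ u] by (auto simp: class_L_def) metis
  obtain D w' where w': "D-lipschitz_on UNIV w'" "\<And>x. x \<in> I \<Longrightarrow> w' x = w x"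
    using w_L Lipschitz_extension[OF _ neI, of _ w] by (auto simp: class_L_def w_def) metis
  have superlevel: "{x \<in> I. c < w' x} = {0<..<measure lebesgue {x \<in> I. c < u' x}}" if "0 \<le> c" for c
  proof -
    have "{x \<in> I. c < w' x} = {x \<in> I. c < w x}" "{x \<in> I. c < u' x} = {x \<in> I. c < u x}"
      using u'(2) w'(2) by auto
    then show ?thesis using superlevel_rearr[OF _ \<alpha> that, of u] u_L by (simp add: w_def I_def)
  qed
  have superlevel_meas: "{x \<in> I. c < u' x} \<in> lmeasurable" if "0 \<le> c" for c
  proof -
    have "{x \<in> I. c < u' x} = {x \<in> I. c < u x}" using u'(2) by auto
    then show ?thesis using lmeasurable_superlevel[OF u_L I_meas that] by simp
  qed
  have anti: "w' y \<le> w' x" if "0 < x" "x \<le> y" "y \<in> I" for x y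
    using decr_rearr_antimono[OF u_L I_meas that(1,2)] that ival_downward[of y \<alpha> x] w'(2)
    by (simp add: w_def I_def)
  have restr: "g' \<in> borel_measurable (lebesgue_on I)"
    if "g \<in> borel_measurable (lebesgue_on I)" "\<And>x. x \<in> I \<Longrightarrow> g' x = g x" for g g' :: "real \<Rightarrow> real"
    using that measurable_cong[of "lebesgue_on I" g' g borel] by simp
  have distr: "distr (lebesgue_on I) borel u' = distr (lebesgue_on I) borel w'"
  proof (rule distr_eq_of_superlevels[OF I_meas])
    show "u' \<in> borel_measurable (lebesgue_on I)" "w' \<in> borel_measurable (lebesgue_on I)"
      using restr u_meas w_meas u'(2) w'(2) by blast+
    show "emeasure lebesgue {x \<in> I. c < u' x} < \<infinity>" if "0 \<le> c" for c
      using superlevel_meas[OF that] unfolding fmeasurable_def by blast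
    show "emeasure lebesgue {x \<in> I. c < u' x} = emeasure lebesgue {x \<in> I. c < w' x}" if "0 \<le> c" for c
      unfolding superlevel[OF that] using superlevel_meas[OF that] by (simp add: emeasure_eq_measure2)
  qed (use u_nonneg w_nonneg u'(2) w'(2) in auto)
  (* The value 0 belongs to Z because {u = 0} may have infinite measure, while the distribution
     off Z has to be finite. *)
  obtain Z where Z: "Z \<in> sets borel" "negligible Z"
    and Z0: "0 \<in> Z" and crit: "\<And>x. x \<in> I \<Longrightarrow> deriv0 u' x = 0 \<Longrightarrow> u' x \<in> Z"
      "\<And>x. x \<in> I \<Longrightarrow> deriv0 w' x = 0 \<Longrightarrow> w' x \<in> Z"
  proof -
    have neg: "negligible (g ` {x. deriv0 g x = 0})" if g: "K-lipschitz_on UNIV g" for K g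
    proof -
      let ?A = "{x. g differentiable (at x) \<and> deriv0 g x = 0}" and ?B = "{x. \<not> g differentiable (at x)}"
      have B: "negligible ?B" by (rule negligible_Lipschitz_not_differentiable[OF g])
      have A: "?A = deriv0 g -` {0} - ?B" by auto
      have "?A \<in> sets lebesgue"
        unfolding A using measurable_sets[OF borel_measurable_deriv0[OF g], of "{0}"]
          negligible_imp_sets[OF B] by auto
      then have "negligible (g ` ?A)"
        by (rule negligible_critical_values[OF g]) (use has_real_derivative_deriv0 in force)
      moreover have "negligible (g ` ?B)" by (rule negligible_Lipschitz_image[OF g B])
      moreover have "g ` {x. deriv0 g x = 0} \<subseteq> g ` ?A \<union> g ` ?B" by auto
      ultimately show ?thesis by (meson negligible_Un negligible_subset)
    qed
    have "negligible ({0} \<union> u' ` {x. deriv0 u' x = 0} \<union> w' ` {x. deriv0 w' x = 0})"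
      using neg[OF u'(1)] neg[OF w'(1)] by (intro negligible_Un) auto
    then obtain Z where "Z \<in> sets borel" "negligible Z"
       "{0} \<union> u' ` {x. deriv0 u' x = 0} \<union> w' ` {x. deriv0 w' x = 0} \<subseteq> Z"
      using negligible_Borel_superset by metis
    then show ?thesis using that[of Z] by blast
  qed
  define E0 where "E0 g x = ennreal (G (f x * \<bar>deriv0 g x\<bar>) (g x)) * indicator I x" for g x
  have E_deriv: "(\<integral>\<^sup>+ x\<in>I. ennreal (G (f x * \<bar>deriv g x\<bar>) (g x)) \<partial>lebesgue) = (\<integral>\<^sup>+ x. E0 g' x \<partial>lebesgue)"
    if g': "K-lipschitz_on UNIV g'" "\<forall>x\<in>I. g' x = g x" for g g' :: "real \<Rightarrow> real" and K
  proof (rule nn_integral_cong_AE)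
    have "deriv g x = deriv0 g' x" if "(g' has_real_derivative deriv0 g' x) (at x)" "x \<in> I" for x
    proof -
      have "eventually (\<lambda>x. g' x = g x) (nhds x)"
        using eventually_nhds_in_open[OF openI that(2)] by (auto elim!: eventually_mono simp: g'(2))
      then have "(g has_real_derivative deriv0 g' x) (at x)"
        using that(1) DERIV_cong_ev[of x x g' g] by blast
      then show ?thesis by (rule DERIV_imp_deriv)
    qed
    note deriv_eq = this
    show "AE x in lebesgue. ennreal (G (f x * \<bar>deriv g x\<bar>) (g x)) * indicator I x = E0 g' x"
      using AE_has_real_derivative_deriv0[OF g'(1)]
      by eventually_elim (simp add: E0_def indicator_def deriv_eq g'(2))
  qed
  have E0_meas: "E0 g \<in> borel_measurable lebesgue"
    if g: "K-lipschitz_on UNIV g" and nonneg: "\<And>x. x \<in> I \<Longrightarrow> 0 \<le> g x" for g K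
  proof -
    define G' where "G' p = G (max 0 (fst p)) (max 0 (snd p))" for p :: "real \<times> real"
    have "continuous_on UNIV (\<lambda>p :: real \<times> real. (\<lambda>(z, v). G z v) (max 0 (fst p), max 0 (snd p)))"
      by (rule continuous_on_compose2[OF G_cont]) (auto intro!: continuous_intros)
    then have [measurable]: "G' \<in> borel_measurable borel"
      by (intro borel_measurable_continuous_onI) (simp add: G'_def[abs_def])
    have "continuous_on I f" using f_cont closure_subset continuous_on_subset by blast
    then have "(\<lambda>x. indicator I x *\<^sub>R f x) \<in> borel_measurable borel"
      using openI by (intro borel_measurable_continuous_on_indicator) auto
    then have fm[measurable]: "(\<lambda>x. indicator I x *\<^sub>R f x) \<in> borel_measurable lebesgue"
      by (intro measurable_completion) simp
    have gm[measurable]: "g \<in> borel_measurable lebesgue"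
      using borel_measurable_Lipschitz[OF g] by (intro measurable_completion) simp
    have dm[measurable]: "deriv0 g \<in> borel_measurable lebesgue" by (rule borel_measurable_deriv0[OF g])
    note I_meas[measurable]
    have "(\<lambda>x. ennreal (G' ((indicator I x *\<^sub>R f x) * \<bar>deriv0 g x\<bar>, g x)) * indicator I x) \<in> borel_measurable lebesgue"
      by measurable
    also have "(\<lambda>x. ennreal (G' ((indicator I x *\<^sub>R f x) * \<bar>deriv0 g x\<bar>, g x)) * indicator I x) = E0 g"
      using f_pos nonneg by (auto simp: fun_eq_iff E0_def G'_def indicator_def max_def less_imp_le not_less
          zero_le_mult_iff split: if_splits) 
    finally show ?thesis .
  qed
  (* The points over Z contribute an integral against the distribution of g, the others an
     integral over the levels. *)
  have split: "(\<integral>\<^sup>+ x. E0 g x \<partial>lebesgue) = (\<integral>\<^sup>+ c. ennreal (G 0 (max 0 c)) * indicator Z c \<partial>distr (lebesgue_on I) borel g) +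
      (\<integral>\<^sup>+ c. indicator (- Z) c * (\<integral>\<^sup>+x. ennreal (G (f x * \<bar>deriv0 g x\<bar>) c) * ennreal (1 / \<bar>deriv0 g x\<bar>) \<partial>count_space {x \<in> I. g x = c}) \<partial>lebesgue)"
    if g: "K-lipschitz_on UNIV g" and "\<forall>x\<in>I. 0 \<le> g x"
      and "\<forall>x\<in>I. deriv0 g x = 0 \<longrightarrow> g x \<in> Z" for g K
  proof -
    have nonneg: "0 \<le> g x" if "x \<in> I" for x using \<open>\<forall>x\<in>I. 0 \<le> g x\<close> that by blast
    have crit: "g x \<in> Z" if "x \<in> I" "deriv0 g x = 0" for x
      using \<open>\<forall>x\<in>I. deriv0 g x = 0 \<longrightarrow> g x \<in> Z\<close> that by blast
    have Em[measurable]: "E0 g \<in> borel_measurable lebesgue" by (rule E0_meas[OF g]) (rule nonneg)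
    have [measurable]: "g -` Z \<in> sets lebesgue" by (rule vimage_Lipschitz_lebesgue[OF g Z(1)])
    have "(\<integral>\<^sup>+ x. E0 g x \<partial>lebesgue) = (\<integral>\<^sup>+ x. E0 g x * indicator (g -` Z) x + E0 g x * indicator {x \<in> I. g x \<notin> Z} x \<partial>lebesgue)"
      by (intro nn_integral_cong) (auto simp: E0_def indicator_def)
    also have "\<dots> = (\<integral>\<^sup>+ x. E0 g x * indicator (g -` Z) x \<partial>lebesgue) +
        (\<integral>\<^sup>+ x. E0 g x * indicator {x \<in> I. g x \<notin> Z} x \<partial>lebesgue)"
    proof (rule nn_integral_add)
      have "{x \<in> I. g x \<notin> Z} = I - g -` Z" by auto
      then have "{x \<in> I. g x \<notin> Z} \<in> sets lebesgue" using I_meas by auto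
      then show "(\<lambda>x. E0 g x * indicator {x \<in> I. g x \<notin> Z} x) \<in> borel_measurable lebesgue" by measurable
    qed measurable
    also have "(\<integral>\<^sup>+ x. E0 g x * indicator {x \<in> I. g x \<notin> Z} x \<partial>lebesgue) =
       (\<integral>\<^sup>+ c. indicator (- Z) c * (\<integral>\<^sup>+x. E0 g x * ennreal (1 / \<bar>deriv0 g x\<bar>) \<partial>count_space {x \<in> I. g x = c}) \<partial>lebesgue)"
      by (rule coarea_off_critical_values(2)[OF g I_meas Z(1) crit Em])
    also have "\<dots> = (\<integral>\<^sup>+ c. indicator (- Z) c * (\<integral>\<^sup>+x. ennreal (G (f x * \<bar>deriv0 g x\<bar>) c) * ennreal (1 / \<bar>deriv0 g x\<bar>) \<partial>count_space {x \<in> I. g x = c}) \<partial>lebesgue)"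
      by (intro nn_integral_cong arg_cong2[where f = "(*)"] refl) (auto simp: E0_def)
    also have "(\<integral>\<^sup>+ x. E0 g x * indicator (g -` Z) x \<partial>lebesgue) =
        (\<integral>\<^sup>+ x. (ennreal (G 0 (max 0 (g x))) * indicator Z (g x)) * indicator I x \<partial>lebesgue)"
    proof (rule nn_integral_cong_AE)
      show "AE x in lebesgue. E0 g x * indicator (g -` Z) x =
          (ennreal (G 0 (max 0 (g x))) * indicator Z (g x)) * indicator I x"
        using AE_critical_on_null_preimage[OF g Z]
        by eventually_elim (use nonneg in \<open>auto simp: E0_def indicator_def max_def\<close>)
    qed
    also have "\<dots> = (\<integral>\<^sup>+ x. ennreal (G 0 (max 0 (g x))) * indicator Z (g x) \<partial>lebesgue_on I)"
      using I_meas by (simp add: nn_integral_restrict_space)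
    also have "\<dots> = (\<integral>\<^sup>+ c. ennreal (G 0 (max 0 c)) * indicator Z c \<partial>distr (lebesgue_on I) borel g)"
    proof (rule nn_integral_distr[symmetric])
      have "g \<in> borel_measurable lebesgue"
        using borel_measurable_Lipschitz[OF g] by (intro measurable_completion) simp
      then show "g \<in> lebesgue_on I \<rightarrow>\<^sub>M borel" by (rule measurable_restrict_space1)
      have "continuous_on UNIV (\<lambda>c :: real. (\<lambda>(z, v). G z v) (0, max 0 c))"
        by (rule continuous_on_compose2[OF G_cont]) (auto intro!: continuous_intros)
      then have [measurable]: "(\<lambda>c. G 0 (max 0 c)) \<in> borel_measurable borel"
        by (intro borel_measurable_continuous_onI) simp
      note Z(1)[measurable]
      have "(\<lambda>c. ennreal (G 0 (max 0 c)) * indicator Z c) \<in> borel_measurable borel" by measurable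
      then show "(\<lambda>c. ennreal (G 0 (max 0 c)) * indicator Z c) \<in> borel_measurable (distr (lebesgue_on I) borel g)"
        by simp
    qed
    finally show ?thesis .
  qed
  have nonneg': "0 \<le> u' x" "0 \<le> w' x" if "x \<in> I" for x
    using that u_nonneg w_nonneg u'(2) w'(2) by auto
  have push: "emeasure lebesgue {x \<in> I. u' x \<in> B} = emeasure lebesgue {x \<in> I. w' x \<in> B}"
    if B: "B \<in> sets borel" for B
  proof -
    have "emeasure (distr (lebesgue_on I) borel g) B = emeasure lebesgue {x \<in> I. g x \<in> B}"
      if g: "K-lipschitz_on UNIV g" for g K
    proof -
      have gm: "g \<in> borel_measurable lebesgue"
        using borel_measurable_Lipschitz[OF g] by (intro measurable_completion) simp
      have "g -` B \<inter> space (lebesgue_on I) = {x \<in> I. g x \<in> B}" by auto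
      then show ?thesis
        using measurable_restrict_space1[OF gm, of I] B I_meas
        by (simp add: emeasure_distr emeasure_restrict_space)
    qed
    from this[OF u'(1)] this[OF w'(1)] show ?thesis using distr by simp
  qed
  have fin: "emeasure lebesgue {x \<in> I. u' x \<notin> Z} < \<infinity>"
  proof -
    have "emeasure lebesgue {x \<in> I. u' x \<notin> Z} \<le> emeasure lebesgue {x \<in> I. 0 < u' x}"
      using Z0 nonneg'(1) superlevel_meas[of 0] by (intro emeasure_mono) (force simp: less_le)+
    also have "\<dots> < \<infinity>" using superlevel_meas[of 0] unfolding fmeasurable_def by blast
    finally show ?thesis .
  qed
  have fin': "emeasure lebesgue {x \<in> I. w' x \<notin> Z} < \<infinity>"
    using fin push[of "- Z"] Z(1) by simp
  have weights: "AE c in lebesgue. c \<notin> Z \<longrightarrow>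
      (\<integral>\<^sup>+x. ennreal (1 / \<bar>deriv0 u' x\<bar>) \<partial>count_space {x \<in> I. u' x = c}) =
      (\<integral>\<^sup>+x. ennreal (1 / \<bar>deriv0 w' x\<bar>) \<partial>count_space {x \<in> I. w' x = c})"
    by (rule AE_level_weights_eq[OF u'(1) w'(1) I_meas Z(1) _ _ _ fin]) (use crit push in auto)
  have finite_levels: "AE c in lebesgue. c \<notin> Z \<longrightarrow> finite {x \<in> I. u' x = c}"
    "AE c in lebesgue. c \<notin> Z \<longrightarrow> finite {x \<in> I. w' x = c}"
    by (rule AE_finite_level_sets[OF u'(1) I_meas Z(1) _ fin], rule crit, assumption+)
      (rule AE_finite_level_sets[OF w'(1) I_meas Z(1) _ fin'], rule crit, assumption+)
  have "AE c in lebesgue. c \<notin> Z \<longrightarrow>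
      (\<integral>\<^sup>+x. ennreal (G (f x * \<bar>deriv0 w' x\<bar>) c) * ennreal (1 / \<bar>deriv0 w' x\<bar>) \<partial>count_space {x \<in> I. w' x = c}) \<le>
      (\<integral>\<^sup>+x. ennreal (G (f x * \<bar>deriv0 u' x\<bar>) c) * ennreal (1 / \<bar>deriv0 u' x\<bar>) \<partial>count_space {x \<in> I. u' x = c})"
    using weights finite_levels
  proof eventually_elim
    case (elim c)
    show ?case
    proof
      assume cZ: "c \<notin> Z"
      show "(\<integral>\<^sup>+x. ennreal (G (f x * \<bar>deriv0 w' x\<bar>) c) * ennreal (1 / \<bar>deriv0 w' x\<bar>) \<partial>count_space {x \<in> I. w' x = c}) \<le>
        (\<integral>\<^sup>+x. ennreal (G (f x * \<bar>deriv0 u' x\<bar>) c) * ennreal (1 / \<bar>deriv0 u' x\<bar>) \<partial>count_space {x \<in> I. u' x = c})"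
      proof (cases "0 \<le> c")
        case c: True
        show ?thesis
          unfolding I_def
        proof (rule level_energy_le[OF \<alpha>])
          show "continuous_on UNIV u'" by (rule lipschitz_on_continuous_on[OF u'(1)])
          show "{x \<in> ival \<alpha>. c < u' x} \<in> lmeasurable" using superlevel_meas[OF c] by (simp add: I_def)
          show "{x \<in> ival \<alpha>. c < w' x} = {0<..<measure lebesgue {x \<in> ival \<alpha>. c < u' x}}"
            using superlevel[OF c] by (simp add: I_def)
          show "w' y \<le> w' x" if "0 < x" "x \<le> y" "y \<in> ival \<alpha>" for x y
            using anti that by (simp add: I_def)
          show "finite {x \<in> ival \<alpha>. u' x = c}" "finite {x \<in> ival \<alpha>. w' x = c}"
            using elim cZ by (auto simp: I_def)
          show "(\<integral>\<^sup>+x. ennreal (1 / \<bar>deriv0 u' x\<bar>) \<partial>count_space {x \<in> ival \<alpha>. u' x = c}) =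
            (\<integral>\<^sup>+x. ennreal (1 / \<bar>deriv0 w' x\<bar>) \<partial>count_space {x \<in> ival \<alpha>. w' x = c})"
            using elim cZ by (simp add: I_def)
          show "deriv0 u' x \<noteq> 0" if "x \<in> ival \<alpha>" "u' x = c" for x
            using crit(1)[of x] that cZ by (auto simp: I_def)
          show "deriv0 w' x \<noteq> 0" if "x \<in> ival \<alpha>" "w' x = c" for x
            using crit(2)[of x] that cZ by (auto simp: I_def)
        qed (use f_pos f_sub f_sym G_nonneg G_convex G_mono c in \<open>simp_all add: I_def\<close>)
      next
        case False
        then have "{x \<in> I. w' x = c} = {}" using nonneg'(2) by force
        then show ?thesis by (simp add: nn_integral_empty)
      qed
    qed
  qed
  then have "(\<integral>\<^sup>+ c. indicator (- Z) c * (\<integral>\<^sup>+x. ennreal (G (f x * \<bar>deriv0 w' x\<bar>) c) * ennreal (1 / \<bar>deriv0 w' x\<bar>) \<partial>count_space {x \<in> I. w' x = c}) \<partial>lebesgue) \<le>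
      (\<integral>\<^sup>+ c. indicator (- Z) c * (\<integral>\<^sup>+x. ennreal (G (f x * \<bar>deriv0 u' x\<bar>) c) * ennreal (1 / \<bar>deriv0 u' x\<bar>) \<partial>count_space {x \<in> I. u' x = c}) \<partial>lebesgue)"
    by (intro nn_integral_mono_AE) (auto simp: indicator_def elim!: AE_mp intro!: AE_I2)
  moreover have "\<forall>x\<in>I. 0 \<le> u' x" "\<forall>x\<in>I. 0 \<le> w' x" using nonneg' by auto
  moreover have "\<forall>x\<in>I. deriv0 u' x = 0 \<longrightarrow> u' x \<in> Z" "\<forall>x\<in>I. deriv0 w' x = 0 \<longrightarrow> w' x \<in> Z"
    using crit by auto
  ultimately have "(\<integral>\<^sup>+ x. E0 w' x \<partial>lebesgue) \<le> (\<integral>\<^sup>+ x. E0 u' x \<partial>lebesgue)"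
    using split[OF u'(1)] split[OF w'(1)] distr by (simp add: add_left_mono)
  then show "(\<integral>\<^sup>+ x\<in>I. ennreal (G (f x * \<bar>deriv (decr_rearr I u) x\<bar>) (decr_rearr I u x)) \<partial>lebesgue) \<le>
    (\<integral>\<^sup>+ x\<in>I. ennreal (G (f x * \<bar>deriv u x\<bar>) (u x)) \<partial>lebesgue)"
    using E_deriv[OF u'(1), of u] E_deriv[OF w'(1), of w] u'(2) w'(2) by (simp add: w_def)
qed

end
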